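(* Let $N\ge 5$ and let $(u^*,\lambda^* )$ be the extremal pair of $(P)_\lambda$ on the unit ball $B\subset\mathbb{R}^N$. If $u^*$ is singular (i.e. $\sup_B u^*=1$), then $$1-u^*(x)\le C_0|x|^{4/3}\qquad\text{in }B,$$ where $C_0:=\left(\frac{\lambda^*}{\bar\lambda}\right)^{1/3}$ and $\bar\lambda=\bar\lambda_N:=\frac{8}{9}\left(N-\frac23\right)\left(N-\frac83\right)$.
   Context: $B$ is the open unit ball of $\mathbb{R}^N$ and $\partial_\nu$ is the outer normal derivative on $\partial B$. For $\lambda>0$, $(P)_\lambda$ denotes the problem $$\Delta^2u=\frac{\lambda}{(1-u)^2}\ \text{in }B,\qquad 0<u<1\ \text{in }B,\qquad u=\partial_\nu u=0\ \text{on }\partial B.$$ The pull-in voltage is $\lambda^*:=\sup\{\lambda>0:\ (P)_\lambda\text{ has a classical solution}\}$. It is known that $0<\lambda^*<\infty$, that for each $0<\lambda<\lambda^*$ there is a classical minimal solution $u_\lambda$ of $(P)_\lambda$ (pointwise below every other classical solution), that $u_\lambda$ is radial and radially decreasing, and that $\lambda\mapsto u_\lambda(x)$ is strictly increasing on $(0,\lambda^* )$ for each $x\in B$. The extremal solution is $u^*(x):=\lim_{\lambda\nearrow\lambda^*}u_\lambda(x)$, and $(u^*,\lambda^* )$ is called the extremal pair. *)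

theory Defs
  imports "HOL-Analysis.Analysis"
begin

(* Derivatives are taken within S.  For open S these are the ordinary derivatives; for the
   closed ball they are still unique, and one-sided at boundary points. *)
definition partial_deriv ::
  "(real^'n) set \<Rightarrow> 'n \<Rightarrow> (real^'n \<Rightarrow> real) \<Rightarrow> real^'n \<Rightarrow> real" where
  "partial_deriv S i u x = frechet_derivative u (at x within S) (axis i 1)"

primrec C_k_on :: "nat \<Rightarrow> (real^'n) set \<Rightarrow> (real^'n \<Rightarrow> real) \<Rightarrow> bool" where
  "C_k_on 0 S u \<longleftrightarrow> continuous_on S u"
| "C_k_on (Suc k) S u \<longleftrightarrow>
     u differentiable_on S \<and> (\<forall>i. C_k_on k S (partial_deriv S i u))"

definition laplacian :: "(real^'n) set \<Rightarrow> (real^'n \<Rightarrow> real) \<Rightarrow> real^'n \<Rightarrow> real" where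
  "laplacian S u x = (\<Sum>i\<in>UNIV. partial_deriv S i (partial_deriv S i u) x)"

(* The outer unit normal of the unit ball at a boundary point x is x itself. *)
definition normal_deriv :: "(real^'n \<Rightarrow> real) \<Rightarrow> real^'n \<Rightarrow> real" where
  "normal_deriv u x = frechet_derivative u (at x within cball 0 1) x"

(* Classical means C^4 in the open ball and C^1 up to the boundary.  The values of u outside
   the closed ball are irrelevant. *)
definition classical_solution :: "real \<Rightarrow> (real^'n \<Rightarrow> real) \<Rightarrow> bool" where
  "classical_solution lam u \<longleftrightarrow>
     C_k_on 4 (ball 0 1) u \<and> C_k_on 1 (cball 0 1) u \<and>
     (\<forall>x\<in>ball 0 1. laplacian (ball 0 1) (laplacian (ball 0 1) u) x = lam / (1 - u x)\<^sup>2) \<and>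
     (\<forall>x\<in>ball 0 1. 0 < u x \<and> u x < 1) \<and>
     (\<forall>x\<in>sphere 0 1. u x = 0 \<and> normal_deriv u x = 0)"

definition minimal_solution :: "real \<Rightarrow> (real^'n \<Rightarrow> real) \<Rightarrow> bool" where
  "minimal_solution lam u \<longleftrightarrow>
     classical_solution lam u \<and> (\<forall>v. classical_solution lam v \<longrightarrow> (\<forall>x\<in>ball 0 1. u x \<le> v x))"

(* The supremum is taken in the extended reals, where an empty or unbounded set of
   parameters gives an infinite value instead of an arbitrary real. *)
definition pull_in_voltage :: "'n::finite itself \<Rightarrow> ereal" where
  "pull_in_voltage _ =
     Sup (ereal ` {lam. 0 < lam \<and> (\<exists>u :: real^'n \<Rightarrow> real. classical_solution lam u)})"

(* U t is the minimal solution with parameter t; its values in the ball are unique. *)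
definition extremal_pair :: "(real^'n \<Rightarrow> real) \<Rightarrow> real \<Rightarrow> bool" where
  "extremal_pair u lam \<longleftrightarrow>
     ereal lam = pull_in_voltage TYPE('n) \<and>
     (\<exists>U. (\<forall>t\<in>{0<..<lam}. minimal_solution t (U t)) \<and>
          (\<forall>x\<in>ball 0 1. ((\<lambda>t. U t x) \<longlongrightarrow> u x) (at_left lam)))"

definition lambda_bar :: "nat \<Rightarrow> real" where
  "lambda_bar N = 8 / 9 * (real N - 2 / 3) * (real N - 8 / 3)"

end

theory Submission
  imports Defs
begin

text \<open>Put \<open>W = 1 - C\<^sub>0 |x|\<^sup>4\<^sup>/\<^sup>3 - \<gamma>\<close>.  Since \<open>1 - C\<^sub>0 |x|\<^sup>4\<^sup>/\<^sup>3\<close> solves the equation with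
  parameter \<open>\<lambda>\<^sup>*\<close>, the shifted function \<open>W\<close> is a supersolution for every \<open>t < \<lambda>\<^sup>*\<close>, and it is at most
  \<open>1 - \<gamma>\<close> at the origin.  If the bound failed at \<open>x\<^sub>0\<close>, then for small \<open>\<gamma>\<close> and \<open>t\<close> close to \<open>\<lambda>\<^sup>*\<close>
  the minimal solution \<open>u\<^sub>t\<close> would lie below \<open>W\<close> at \<open>x\<^sub>0\<close>.  At a radius \<open>R \<ge> |x\<^sub>0|\<close> where \<open>W - u\<^sub>t\<close> is
  maximal, \<open>W \<ge> u\<^sub>t\<close> and \<open>W' \<le> u\<^sub>t'\<close>.  The monotone iteration for \<open>u\<^sub>t\<close> started at \<open>0\<close> consists of radial
  functions \<open>v\<close> with \<open>u\<^sub>t - v\<close> nonnegative and radially decreasing, so \<open>W \<ge> v\<close> and \<open>W' \<le> v'\<close> at \<open>R\<close>, and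
  Boggio's principle on the ball of radius \<open>R\<close> keeps every iterate below \<open>W\<close>.  By minimality the
  iterates converge to \<open>u\<^sub>t\<close>, whence \<open>u\<^sub>t(0) \<le> 1 - \<gamma>\<close>, against \<open>u\<^sub>t(0) \<rightarrow> u\<^sup>*(0) = 1\<close>.

  Radial functions are written as functions of \<open>s = |x|\<^sup>2\<close>: with \<open>a = N/2\<close>, the Laplacian of \<open>F(|x|\<^sup>2)\<close> is
  \<open>4 (s F'' + a F') = 4 s\<^sup>1\<^sup>-\<^sup>a (s\<^sup>a F')'\<close>, and a smooth \<open>F\<close> gives a smooth function at the origin.\<close>

section \<open>Derivatives within a set\<close>

text \<open>\<open>frechet_derivative\<close> is a choice operator, so it can be computed only where
  the derivative within \<open>S\<close> is unique. The predicate treats the open and the closed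
  ball alike.\<close>

definition unique_deriv :: "(real^'n) set \<Rightarrow> bool" where
  "unique_deriv S \<longleftrightarrow> (\<forall>x\<in>S. \<forall>(f::real^'n \<Rightarrow> real) f' f''.
     (f has_derivative f') (at x within S) \<longrightarrow> (f has_derivative f'') (at x within S) \<longrightarrow> f' = f'')"

lemma unique_deriv_open: "open S \<Longrightarrow> unique_deriv S"
  unfolding unique_deriv_def by (metis at_within_open has_derivative_unique)

text \<open>The one-sided derivative along the segment from \<open>x\<close> to \<open>y\<close>
  fixes \<open>f' (y - x)\<close> for every \<open>y\<close> in \<open>S\<close>. Since
  \<open>S\<close> contains a ball, every vector is a multiple of a difference of two such
  vectors.\<close>

lemma unique_deriv_convex:
  fixes S :: "(real^'n) set"
  assumes "convex S" "interior S \<noteq> {}"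
  shows "unique_deriv S"
  unfolding unique_deriv_def
proof (intro ballI allI impI)
  fix x and f :: "real^'n \<Rightarrow> real" and f' f''
  assume x: "x \<in> S" and d1: "(f has_derivative f') (at x within S)"
    and d2: "(f has_derivative f'') (at x within S)"
  have dir: "f' (y - x) = f'' (y - x)" if y: "y \<in> S" for y
  proof -
    let ?g = "\<lambda>\<tau>::real. x + \<tau> *\<^sub>R (y - x)"
    have im: "?g ` {0..1} \<subseteq> S"
    proof clarify
      fix \<tau> :: real assume "\<tau> \<in> {0..1}"
      then have "(1 - \<tau>) *\<^sub>R x + \<tau> *\<^sub>R y \<in> S"
        using assms(1) x y by (simp add: convex_alt)
      then show "x + \<tau> *\<^sub>R (y - x) \<in> S" by (simp add: algebra_simps)
    qed
    have "((f \<circ> ?g) has_vector_derivative h (y - x)) (at 0 within {0..1})"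
      if "(f has_derivative h) (at x within S)" for h
    proof -
      have "(?g has_derivative (\<lambda>\<tau>. \<tau> *\<^sub>R (y - x))) (at 0 within {0..1})"
        by (auto intro!: derivative_eq_intros)
      moreover have "(f has_derivative h) (at (?g 0) within ?g ` {0..1})"
        using has_derivative_subset[OF that im] by simp
      ultimately have "((f \<circ> ?g) has_derivative (h \<circ> (\<lambda>\<tau>. \<tau> *\<^sub>R (y - x)))) (at 0 within {0..1})"
        by (rule diff_chain_within)
      moreover have "h (\<tau> *\<^sub>R (y - x)) = \<tau> *\<^sub>R h (y - x)" for \<tau>
        using that by (simp add: has_derivative_bounded_linear linear_simps(5))
      ultimately show ?thesis
        unfolding has_vector_derivative_def by (simp add: o_def)
    qed
    from this[OF d1] this[OF d2] show ?thesis
      by (rule vector_derivative_unique_within[rotated])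
        (simp add: trivial_limit_within)
  qed
  obtain y0 where "y0 \<in> interior S" using assms by blast
  then obtain e where e: "e > 0" "ball y0 e \<subseteq> S"
    by (meson mem_interior)
  have l1: "linear f'" and l2: "linear f''"
    using d1 d2 has_derivative_linear by auto
  show "f' = f''"
  proof
    fix v :: "real^'n"
    \<comment> \<open>Scaling by \<open>c\<close> keeps \<open>y0 + c *\<^sub>R v\<close> in the
      ball around \<open>y0\<close>; the summand 1 covers \<open>v = 0\<close>.\<close>
    define c where "c = e / (2 * (1 + norm v))"
    have c: "c > 0" using e by (simp add: c_def add_pos_nonneg)
    have "c * norm v < e"
    proof -
      have "c * norm v \<le> c * (1 + norm v)" using c by simp
      also have "\<dots> = e / 2"
        unfolding c_def using norm_ge_zero[of v]
        by (simp add: divide_simps) (smt (verit, del_insts) norm_ge_zero)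
      finally show ?thesis using e by simp
    qed
    then have "y0 + c *\<^sub>R v \<in> S" "y0 \<in> S" using e c by (auto simp: dist_norm intro!: subsetD[OF e(2)])
    from dir[OF this(1)] dir[OF this(2)]
    have "f' (y0 + c *\<^sub>R v - x) - f' (y0 - x) = f'' (y0 + c *\<^sub>R v - x) - f'' (y0 - x)" by simp
    then have "f' (c *\<^sub>R v) = f'' (c *\<^sub>R v)"
      unfolding linear_diff[OF l1, symmetric] linear_diff[OF l2, symmetric] by simp
    then show "f' v = f'' v"
      using c by (simp add: linear_scale[OF l1] linear_scale[OF l2])
  qed
qed

lemma unique_deriv_cball: "unique_deriv (cball (0::real^'n) 1)"
  by (rule unique_deriv_convex) auto

lemma unique_deriv_ball: "unique_deriv (ball (0::real^'n) 1)"
  by (simp add: unique_deriv_open)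

lemma frechet_derivative_within_eq:
  fixes u :: "real^'n \<Rightarrow> real"
  assumes "unique_deriv S" "x \<in> S" "(u has_derivative u') (at x within S)"
  shows "frechet_derivative u (at x within S) = u'"
proof -
  have "(u has_derivative frechet_derivative u (at x within S)) (at x within S)"
    using assms(3) differentiableI frechet_derivative_works by blast
  then show ?thesis using assms unfolding unique_deriv_def by blast
qed

lemma partial_derivI:
  assumes "unique_deriv S" "x \<in> S" "(u has_derivative u') (at x within S)"
  shows "partial_deriv S i u x = u' (axis i 1)"
  by (simp add: partial_deriv_def frechet_derivative_within_eq[OF assms])

lemma partial_deriv_cong:
  assumes "x \<in> S" "\<And>y. y \<in> S \<Longrightarrow> u y = v y"
  shows "partial_deriv S i u x = partial_deriv S i v x"
proof -
  have "(u has_derivative f') (at x within S) = (v has_derivative f') (at x within S)" for f'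
    using assms by (metis has_derivative_transform)
  then show ?thesis by (simp add: partial_deriv_def frechet_derivative_def)
qed

lemma laplacian_cong:
  assumes "x \<in> S" "\<And>y. y \<in> S \<Longrightarrow> u y = v y"
  shows "laplacian S u x = laplacian S v x"
  unfolding laplacian_def using assms by (intro sum.cong refl partial_deriv_cong) auto

lemma C_k_on_cong:
  assumes "\<And>y. y \<in> S \<Longrightarrow> u y = v y"
  shows "C_k_on k S u = C_k_on k S v"
  using assms
proof (induction k arbitrary: u v)
  case 0 then show ?case by (simp cong: continuous_on_cong)
next
  case (Suc k)
  have "C_k_on k S (partial_deriv S i u) = C_k_on k S (partial_deriv S i v)" for i
    by (rule Suc.IH) (metis Suc.prems partial_deriv_cong)
  moreover have "(u differentiable_on S) = (v differentiable_on S)"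
    using Suc.prems unfolding differentiable_on_def differentiable_def by (metis has_derivative_transform)
  ultimately show ?case by simp
qed

lemma C_k_on_lower: "C_k_on (Suc k) S u \<Longrightarrow> C_k_on k S u"
proof (induction k arbitrary: u)
  case 0 then show ?case by (simp add: differentiable_imp_continuous_on)
next
  case (Suc k) then show ?case by auto
qed

lemma C_k_on_mono: "C_k_on k S u \<Longrightarrow> m \<le> k \<Longrightarrow> C_k_on m S u"
  by (induction k) (use C_k_on_lower le_Suc_eq in \<open>auto simp del: C_k_on.simps\<close>)

text \<open>\<open>C_k_on\<close> refers to chosen derivatives; uniqueness lets any explicit formula
  for the derivative replace them, so the closure properties below become inductions on
  \<open>k\<close>.\<close>

lemma C_k_on_SucI:
  assumes "unique_deriv S" "\<And>x. x \<in> S \<Longrightarrow> (u has_derivative u' x) (at x within S)"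
    "\<And>i. C_k_on k S (\<lambda>x. u' x (axis i 1))"
  shows "C_k_on (Suc k) S u"
proof -
  have "u differentiable_on S"
    using assms(2) differentiable_on_def differentiableI by blast
  moreover have "C_k_on k S (partial_deriv S i u)" for i
    using assms(3)[of i] C_k_on_cong[of S "partial_deriv S i u" "\<lambda>x. u' x (axis i 1)" k]
      partial_derivI[OF assms(1) _ assms(2)] by blast
  ultimately show ?thesis by simp
qed

lemma has_derivative_partials:
  fixes u :: "real^'n \<Rightarrow> real"
  assumes "u differentiable_on S" "x \<in> S"
  shows "(u has_derivative (\<lambda>v. \<Sum>j\<in>UNIV. v $ j * partial_deriv S j u x)) (at x within S)"
proof -
  let ?f = "frechet_derivative u (at x within S)"
  have d: "(u has_derivative ?f) (at x within S)"
    using assms differentiable_on_def frechet_derivative_works by blast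
  then have l: "linear ?f" by (rule has_derivative_linear)
  have "?f v = (\<Sum>j\<in>UNIV. v $ j * partial_deriv S j u x)" for v
  proof -
    have "?f v = ?f (\<Sum>j\<in>UNIV. v $ j *\<^sub>R axis j 1)"
      using basis_expansion[of v] by (simp add: scalar_mult_eq_scaleR)
    then show ?thesis by (simp add: linear_sum[OF l] linear_scale[OF l] partial_deriv_def)
  qed
  then show ?thesis using d by presburger
qed

section \<open>Algebra of C^k functions on a set\<close>

lemma C_k_on_const: "unique_deriv S \<Longrightarrow> C_k_on k S (\<lambda>x. c)"
proof (induction k arbitrary: c)
  case (Suc k)
  show ?case by (rule C_k_on_SucI[OF Suc.prems has_derivative_const]) (rule Suc.IH[OF Suc.prems])
qed simp

lemma C_k_on_component:
  fixes S :: "(real^'n) set"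
  assumes "unique_deriv S"
  shows "C_k_on k S (\<lambda>x. x $ i)"
proof (cases k)
  case (Suc m)
  have "((\<lambda>x. x $ i) has_derivative (\<lambda>x. x $ i)) (at x within S)" for x :: "real^'n"
    by (simp add: bounded_linear_imp_has_derivative bounded_linear_vec_nth)
  then show ?thesis unfolding Suc by (rule C_k_on_SucI[OF assms]) (simp add: C_k_on_const assms)
qed (auto intro!: continuous_intros)

lemma C_k_on_add:
  assumes "unique_deriv S" "C_k_on k S u" "C_k_on k S v"
  shows "C_k_on k S (\<lambda>x. u x + v x)"
  using assms(2,3)
proof (induction k arbitrary: u v)
  case 0 then show ?case by (auto intro!: continuous_intros)
next
  case (Suc k)
  show ?case
  proof (rule C_k_on_SucI[OF assms(1)])
    show "((\<lambda>x. u x + v x) has_derivative (\<lambda>w. (\<Sum>j\<in>UNIV. w $ j * partial_deriv S j u x) +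
        (\<Sum>j\<in>UNIV. w $ j * partial_deriv S j v x))) (at x within S)" if "x \<in> S" for x
      using Suc.prems that by (intro has_derivative_add has_derivative_partials) auto
    show "C_k_on k S (\<lambda>x. (\<Sum>j\<in>UNIV. axis i 1 $ j * partial_deriv S j u x) +
        (\<Sum>j\<in>UNIV. axis i 1 $ j * partial_deriv S j v x))" for i
      using Suc by (simp add: axis_def if_distrib[of "\<lambda>t. t * _"] cong: if_cong)
  qed
qed

lemma C_k_on_mult:
  assumes "unique_deriv S" "C_k_on k S u" "C_k_on k S v"
  shows "C_k_on k S (\<lambda>x. u x * v x)"
  using assms(2,3)
proof (induction k arbitrary: u v)
  case 0 then show ?case by (auto intro!: continuous_intros)
next
  case (Suc k)
  show ?case
  proof (rule C_k_on_SucI[OF assms(1)])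
    show "((\<lambda>x. u x * v x) has_derivative (\<lambda>w. u x * (\<Sum>j\<in>UNIV. w $ j * partial_deriv S j v x) +
        (\<Sum>j\<in>UNIV. w $ j * partial_deriv S j u x) * v x)) (at x within S)" if "x \<in> S" for x
      using Suc.prems that by (intro has_derivative_mult has_derivative_partials) auto
    have "C_k_on k S u" "C_k_on k S v" using Suc.prems C_k_on_lower by blast+
    then have "C_k_on k S (\<lambda>x. u x * partial_deriv S i v x + partial_deriv S i u x * v x)" for i
      using Suc.prems by (intro C_k_on_add assms(1) Suc.IH) auto
    then show "C_k_on k S (\<lambda>x. u x * (\<Sum>j\<in>UNIV. axis i 1 $ j * partial_deriv S j v x) +
        (\<Sum>j\<in>UNIV. axis i 1 $ j * partial_deriv S j u x) * v x)" for i
      by (simp add: axis_def if_distrib[of "\<lambda>t. t * _"] cong: if_cong)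
  qed
qed

lemma C_k_on_sum:
  assumes "unique_deriv S" "finite J" "\<And>j. j \<in> J \<Longrightarrow> C_k_on k S (u j)"
  shows "C_k_on k S (\<lambda>x. \<Sum>j\<in>J. u j x)"
  using assms(2,3) by (induction rule: finite_induct) (auto simp: C_k_on_const C_k_on_add assms(1))

section \<open>The radial bilaplacian and Boggio's principle\<close>

text \<open>\<open>p\<close> is \<open>w'\<close>, \<open>L\<close> is a quarter of the Laplacian and \<open>h\<close> a sixteenth of the bilaplacian of \<open>w(|x|\<^sup>2)\<close>;
  the limits at \<open>0\<close> exclude point sources at the origin but allow the singularity of \<open>|x|\<^sup>4\<^sup>/\<^sup>3\<close>.\<close>

definition radial_bilaplace ::
  "real \<Rightarrow> real \<Rightarrow> (real \<Rightarrow> real) \<Rightarrow> (real \<Rightarrow> real) \<Rightarrow> (real \<Rightarrow> real) \<Rightarrow> bool" where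
  "radial_bilaplace a R w p h \<longleftrightarrow>
     continuous_on {0..R} w \<and> continuous_on {0<..R} p \<and>
     ((\<lambda>s. s powr a * p s) \<longlongrightarrow> 0) (at_right 0) \<and>
     (\<exists>L q. (\<forall>s\<in>{0<..<R}. (w has_real_derivative p s) (at s) \<and>
              ((\<lambda>s. s powr a * p s) has_real_derivative s powr (a - 1) * L s) (at s) \<and>
              (L has_real_derivative q s) (at s) \<and>
              ((\<lambda>s. s powr a * q s) has_real_derivative s powr (a - 1) * h s) (at s)) \<and>
            ((\<lambda>s. s powr a * q s) \<longlongrightarrow> 0) (at_right 0))"

lemma radial_bilaplaceI:
  assumes "continuous_on {0..R} w" "continuous_on {0<..R} p"
    "((\<lambda>s. s powr a * p s) \<longlongrightarrow> 0) (at_right 0)" "((\<lambda>s. s powr a * q s) \<longlongrightarrow> 0) (at_right 0)"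
    "\<And>s. s \<in> {0<..<R} \<Longrightarrow> (w has_real_derivative p s) (at s)"
    "\<And>s. s \<in> {0<..<R} \<Longrightarrow> ((\<lambda>s. s powr a * p s) has_real_derivative s powr (a - 1) * L s) (at s)"
    "\<And>s. s \<in> {0<..<R} \<Longrightarrow> (L has_real_derivative q s) (at s)"
    "\<And>s. s \<in> {0<..<R} \<Longrightarrow> ((\<lambda>s. s powr a * q s) has_real_derivative s powr (a - 1) * h s) (at s)"
  shows "radial_bilaplace a R w p h"
  unfolding radial_bilaplace_def using assms by blast

lemma radial_bilaplace_diff:
  assumes "radial_bilaplace a R w p h" "radial_bilaplace a R w' p' h'"
  shows "radial_bilaplace a R (\<lambda>s. w s - w' s) (\<lambda>s. p s - p' s) (\<lambda>s. h s - h' s)"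
proof -
  obtain L q where 1: "\<And>s. s \<in> {0<..<R} \<Longrightarrow> (w has_real_derivative p s) (at s)"
      "\<And>s. s \<in> {0<..<R} \<Longrightarrow> ((\<lambda>s. s powr a * p s) has_real_derivative s powr (a - 1) * L s) (at s)"
      "\<And>s. s \<in> {0<..<R} \<Longrightarrow> (L has_real_derivative q s) (at s)"
      "\<And>s. s \<in> {0<..<R} \<Longrightarrow> ((\<lambda>s. s powr a * q s) has_real_derivative s powr (a - 1) * h s) (at s)"
      "((\<lambda>s. s powr a * q s) \<longlongrightarrow> 0) (at_right 0)"
    using assms(1) unfolding radial_bilaplace_def by blast
  obtain L' q' where 2: "\<And>s. s \<in> {0<..<R} \<Longrightarrow> (w' has_real_derivative p' s) (at s)"
      "\<And>s. s \<in> {0<..<R} \<Longrightarrow> ((\<lambda>s. s powr a * p' s) has_real_derivative s powr (a - 1) * L' s) (at s)"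
      "\<And>s. s \<in> {0<..<R} \<Longrightarrow> (L' has_real_derivative q' s) (at s)"
      "\<And>s. s \<in> {0<..<R} \<Longrightarrow> ((\<lambda>s. s powr a * q' s) has_real_derivative s powr (a - 1) * h' s) (at s)"
      "((\<lambda>s. s powr a * q' s) \<longlongrightarrow> 0) (at_right 0)"
    using assms(2) unfolding radial_bilaplace_def by blast
  have 3: "continuous_on {0..R} w" "continuous_on {0<..R} p" "((\<lambda>s. s powr a * p s) \<longlongrightarrow> 0) (at_right 0)"
    "continuous_on {0..R} w'" "continuous_on {0<..R} p'" "((\<lambda>s. s powr a * p' s) \<longlongrightarrow> 0) (at_right 0)"
    using assms unfolding radial_bilaplace_def by blast+
  show ?thesis
  proof (rule radial_bilaplaceI[where L = "\<lambda>s. L s - L' s" and q = "\<lambda>s. q s - q' s"])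
    show "continuous_on {0..R} (\<lambda>s. w s - w' s)" "continuous_on {0<..R} (\<lambda>s. p s - p' s)"
      using 3 by (auto intro!: continuous_intros)
    show "((\<lambda>s. s powr a * (p s - p' s)) \<longlongrightarrow> 0) (at_right 0)"
      using tendsto_diff[OF 3(3,6)] by (simp add: right_diff_distrib)
    show "((\<lambda>s. s powr a * (q s - q' s)) \<longlongrightarrow> 0) (at_right 0)"
      using tendsto_diff[OF 1(5) 2(5)] by (simp add: right_diff_distrib)
    fix s assume s: "s \<in> {0<..<R}"
    show "((\<lambda>s. w s - w' s) has_real_derivative p s - p' s) (at s)"
      using 1(1)[OF s] 2(1)[OF s] by (rule DERIV_diff)
    show "((\<lambda>s. L s - L' s) has_real_derivative q s - q' s) (at s)"
      using 1(3)[OF s] 2(3)[OF s] by (rule DERIV_diff)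
    show "((\<lambda>s. s powr a * (p s - p' s)) has_real_derivative s powr (a - 1) * (L s - L' s)) (at s)"
      using DERIV_diff[OF 1(2)[OF s] 2(2)[OF s]] by (simp add: right_diff_distrib)
    show "((\<lambda>s. s powr a * (q s - q' s)) has_real_derivative s powr (a - 1) * (h s - h' s)) (at s)"
      using DERIV_diff[OF 1(4)[OF s] 2(4)[OF s]] by (simp add: right_diff_distrib)
  qed
qed

lemma radial_bilaplace_restrict:
  assumes "radial_bilaplace a R w p h" "R' \<le> R"
  shows "radial_bilaplace a R' w p h"
proof -
  have "{0..R'} \<subseteq> {0..R}" "{0<..R'} \<subseteq> {0<..R}" "{0<..<R'} \<subseteq> {0<..<R}" using assms(2) by auto
  then show ?thesis
    using assms(1) unfolding radial_bilaplace_def by (meson continuous_on_subset subsetD)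
qed

text \<open>\<open>G\<close> is nondecreasing on (0, s], so its limit at 0 bounds \<open>G s\<close>
  from below. The origin enters through this limit only.\<close>

lemma flux_nonneg:
  fixes G :: "real \<Rightarrow> real"
  assumes "\<And>\<sigma>. 0 < \<sigma> \<Longrightarrow> \<sigma> \<le> s \<Longrightarrow> \<exists>y. (G has_real_derivative y) (at \<sigma>) \<and> y \<ge> 0"
    and lim: "(G \<longlongrightarrow> 0) (at_right 0)" and "0 < s"
  shows "G s \<ge> 0"
proof (rule tendsto_upperbound[OF lim])
  have "G \<sigma> \<le> G s" if "0 < \<sigma>" "\<sigma> < s" for \<sigma>
    using that assms(1) by (intro DERIV_nonneg_imp_nondecreasing[of \<sigma> s G]) auto
  then show "\<forall>\<^sub>F \<sigma> in at_right 0. G \<sigma> \<le> G s"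
    using eventually_at_right_real[OF assms(3)] by (auto elim!: eventually_mono)
qed simp

text \<open>The flux of the Laplacian is nonnegative, so the Laplacian increases, so the flux of \<open>w\<close> cannot become positive and
  return to a nonpositive value at the boundary.\<close>

lemma radial_boggio:
  assumes w: "radial_bilaplace a R w p h" and h: "\<And>s. s \<in> {0<..<R} \<Longrightarrow> h s \<ge> 0" and pR: "p R \<le> 0"
  shows "s \<in> {0<..R} \<Longrightarrow> p s \<le> 0" and "0 \<le> s \<Longrightarrow> s \<le> s' \<Longrightarrow> s' \<le> R \<Longrightarrow> w s' \<le> w s"
proof -
  obtain L q where d: "\<And>s. s \<in> {0<..<R} \<Longrightarrow> (w has_real_derivative p s) (at s)"
      "\<And>s. s \<in> {0<..<R} \<Longrightarrow> ((\<lambda>s. s powr a * p s) has_real_derivative s powr (a - 1) * L s) (at s)"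
      "\<And>s. s \<in> {0<..<R} \<Longrightarrow> (L has_real_derivative q s) (at s)"
      "\<And>s. s \<in> {0<..<R} \<Longrightarrow> ((\<lambda>s. s powr a * q s) has_real_derivative s powr (a - 1) * h s) (at s)"
      "((\<lambda>s. s powr a * q s) \<longlongrightarrow> 0) (at_right 0)"
    using w unfolding radial_bilaplace_def by blast
  have c: "continuous_on {0..R} w" "continuous_on {0<..R} p" "((\<lambda>s. s powr a * p s) \<longlongrightarrow> 0) (at_right 0)"
    using w unfolding radial_bilaplace_def by blast+
  have q: "q s \<ge> 0" if "s \<in> {0<..<R}" for s
  proof -
    have "s powr a * q s \<ge> 0"
    proof (rule flux_nonneg[where G = "\<lambda>s. s powr a * q s", OF _ d(5)])
      fix \<sigma> assume "0 < \<sigma>" "\<sigma> \<le> s"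
      then have "\<sigma> \<in> {0<..<R}" using that by auto
      then show "\<exists>y. ((\<lambda>s. s powr a * q s) has_real_derivative y) (at \<sigma>) \<and> y \<ge> 0"
        using d(4) h by (intro exI[of _ "\<sigma> powr (a - 1) * h \<sigma>"]) simp
    qed (use that in auto)
    then show ?thesis using that by (simp add: zero_le_mult_iff)
  qed
  have L: "L s \<le> L s'" if "0 < s" "s \<le> s'" "s' < R" for s s'
  proof (rule DERIV_nonneg_imp_nondecreasing[OF that(2)])
    show "\<exists>y. (L has_real_derivative y) (at x) \<and> y \<ge> 0" if "s \<le> x" "x \<le> s'" for x
      using d(3)[of x] q[of x] that \<open>0 < s\<close> \<open>s' < R\<close> by auto
  qed
  have p: "p s \<le> 0" if s: "s \<in> {0<..<R}" for s
  proof (rule ccontr)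
    assume pos: "\<not> p s \<le> 0"
    show False
    \<comment> \<open>If \<open>L s > 0\<close>, then \<open>L\<close> stays positive up to
      \<open>R\<close> and the flux increases from a positive value, against
      \<open>p R <= 0\<close>. Otherwise \<open>L <= 0\<close> on (0, s], so the flux decreases from
      its limit 0 and cannot be positive at \<open>s\<close>.\<close>
    proof (cases "L s > 0")
      case True
      have "s powr a * p s \<le> R powr a * p R"
      proof (rule DERIV_nonneg_imp_increasing_open[where f = "\<lambda>s. s powr a * p s"])
        show "\<exists>y. ((\<lambda>s. s powr a * p s) has_real_derivative y) (at x) \<and> 0 \<le> y"
          if "s < x" "x < R" for x
          using d(2)[of x] L[of s x] True that s
          by (intro exI[of _ "x powr (a - 1) * L x"]) simp
        have "continuous_on {s..R} p" using c(2) s by (auto elim: continuous_on_subset)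
        then show "continuous_on {s..R} (\<lambda>s. s powr a * p s)"
          using s by (intro continuous_intros) auto
      qed (use s in auto)
      moreover have "s powr a * p s > 0" using s pos by simp
      moreover have "R powr a * p R \<le> 0" using pR by (simp add: mult_nonneg_nonpos)
      ultimately show False by linarith
    next
      case False
      have "- (s powr a * p s) \<ge> 0"
      proof (rule flux_nonneg[where G = "\<lambda>s. - (s powr a * p s)"])
        show "((\<lambda>s. - (s powr a * p s)) \<longlongrightarrow> 0) (at_right 0)"
          using tendsto_minus[OF c(3)] by simp
        fix \<sigma> assume \<sigma>: "0 < \<sigma>" "\<sigma> \<le> s"
        have "((\<lambda>s. - (s powr a * p s)) has_real_derivative - (\<sigma> powr (a - 1) * L \<sigma>)) (at \<sigma>)"
          using d(2)[of \<sigma>] \<sigma> s by (intro DERIV_minus) auto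
        moreover have "\<sigma> powr (a - 1) * L \<sigma> \<le> 0"
          using L[of \<sigma> s] \<sigma> s False by (auto simp: mult_nonneg_nonpos)
        ultimately show "\<exists>y. ((\<lambda>s. - (s powr a * p s)) has_real_derivative y) (at \<sigma>) \<and> y \<ge> 0"
          by (intro exI[of _ "- (\<sigma> powr (a - 1) * L \<sigma>)"]) simp
      qed (use s in auto)
      then show False using s pos by (auto simp: mult_le_0_iff)
    qed
  qed
  then show "p s \<le> 0" if "s \<in> {0<..R}"
    using that pR by (cases "s = R") auto
  show "w s' \<le> w s" if "0 \<le> s" "s \<le> s'" "s' \<le> R"
  proof (rule DERIV_nonpos_imp_decreasing_open[where f = w, OF that(2)])
    show "\<exists>y. (w has_real_derivative y) (at x) \<and> y \<le> 0" if "s < x" "x < s'" for x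
      using d(1)[of x] p[of x] that \<open>0 \<le> s\<close> \<open>s' \<le> R\<close> by auto
    show "continuous_on {s..s'} w" using c(1) that by (auto elim: continuous_on_subset)
  qed
qed

section \<open>The averaging operator inverting the radial Laplacian\<close>

text \<open>On the interval from 0 to 1 the derivatives are one-sided at the ends, so regularity up
  to \<open>s = 0\<close>, the centre of the ball, is included. The derivative is an existential
  witness, so explicit formulas can be inserted directly.\<close>

primrec C_k_real :: "nat \<Rightarrow> real set \<Rightarrow> (real \<Rightarrow> real) \<Rightarrow> bool" where
  "C_k_real 0 T F \<longleftrightarrow> continuous_on T F"
| "C_k_real (Suc k) T F \<longleftrightarrow>
     (\<exists>F'. (\<forall>s\<in>T. (F has_real_derivative F' s) (at s within T)) \<and> C_k_real k T F')"

lemma C_k_real_imp_continuous: "C_k_real k T F \<Longrightarrow> continuous_on T F"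
  by (cases k) (auto intro: DERIV_continuous_on)

lemma C_k_real_lower: "C_k_real (Suc k) T F \<Longrightarrow> C_k_real k T F"
proof (induction k arbitrary: F)
  case 0
  then show ?case using C_k_real_imp_continuous[of "Suc 0" T F] by simp
next
  case (Suc k)
  then obtain F' where "\<forall>s\<in>T. (F has_real_derivative F' s) (at s within T)" "C_k_real (Suc k) T F'"
    by auto
  then show ?case using Suc.IH[of F'] by auto
qed

lemma C_k_real_const: "C_k_real k T (\<lambda>s. c)"
  by (induction k arbitrary: c) (auto intro!: exI[of _ "\<lambda>s. 0"])

lemma C_k_real_add:
  "C_k_real k T F \<Longrightarrow> C_k_real k T G \<Longrightarrow> C_k_real k T (\<lambda>s. F s + G s)"
proof (induction k arbitrary: F G)
  case 0 then show ?case by (auto intro!: continuous_intros)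
next
  case (Suc k)
  then obtain F' G' where "\<forall>s\<in>T. (F has_real_derivative F' s) (at s within T)" "C_k_real k T F'"
    "\<forall>s\<in>T. (G has_real_derivative G' s) (at s within T)" "C_k_real k T G'" by auto
  then show ?case using Suc.IH by (auto intro!: exI[of _ "\<lambda>s. F' s + G' s"] DERIV_add)
qed

lemma C_k_real_mult:
  "C_k_real k T F \<Longrightarrow> C_k_real k T G \<Longrightarrow> C_k_real k T (\<lambda>s. F s * G s)"
proof (induction k arbitrary: F G)
  case 0 then show ?case by (auto intro!: continuous_intros)
next
  case (Suc k)
  then obtain F' G' where d: "\<forall>s\<in>T. (F has_real_derivative F' s) (at s within T)" "C_k_real k T F'"
    "\<forall>s\<in>T. (G has_real_derivative G' s) (at s within T)" "C_k_real k T G'" by auto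
  have "C_k_real k T (\<lambda>s. F' s * G s + G' s * F s)"
    using C_k_real_lower[OF Suc.prems(1)] C_k_real_lower[OF Suc.prems(2)] d
    by (intro C_k_real_add Suc.IH)
  then show ?case using d
    by (auto intro!: exI[of _ "\<lambda>s. F' s * G s + G' s * F s"] DERIV_mult)
qed

lemma C_k_real_inverse:
  "C_k_real k T F \<Longrightarrow> (\<And>s. s \<in> T \<Longrightarrow> F s \<noteq> 0) \<Longrightarrow> C_k_real k T (\<lambda>s. inverse (F s))"
proof (induction k arbitrary: F)
  case 0 then show ?case by (auto intro!: continuous_intros)
next
  case (Suc k)
  then obtain F' where d: "\<forall>s\<in>T. (F has_real_derivative F' s) (at s within T)" "C_k_real k T F'"
    by auto
  have "C_k_real k T (\<lambda>s. inverse (F s))"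
    using Suc.IH Suc.prems C_k_real_lower by blast
  then have "C_k_real k T (\<lambda>s. (- 1) * F' s * (inverse (F s) * inverse (F s)))"
    by (intro C_k_real_mult C_k_real_const d(2))
  moreover have "((\<lambda>s. inverse (F s)) has_real_derivative (- 1) * F' s * (inverse (F s) * inverse (F s)))
      (at s within T)" if "s \<in> T" for s
    using DERIV_inverse_fun[of F "F' s" s T] d(1) Suc.prems(2) that
    by (simp add: power2_eq_square)
  ultimately show ?case by (auto intro!: exI[of _ "\<lambda>s. (- 1) * F' s * (inverse (F s) * inverse (F s))"])
qed

text \<open>With \<open>a = b + 1\<close>, \<open>p = radial_mean b H\<close> solves \<open>(s\<^sup>a p)' = s\<^sup>a\<^sup>-\<^sup>1 H\<close>; in this form it is as smooth as \<open>H\<close>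
  up to \<open>s = 0\<close>.\<close>

definition radial_mean :: "real \<Rightarrow> (real \<Rightarrow> real) \<Rightarrow> real \<Rightarrow> real" where
  "radial_mean b H s = integral {0..1} (\<lambda>\<tau>. \<tau> powr b * H (s * \<tau>))"

lemma mult_in_unit: "s \<in> {0..1} \<Longrightarrow> \<tau> \<in> {0..1} \<Longrightarrow> s * \<tau> \<in> {0..1::real}"
  by (auto simp: mult_le_one)

lemma radial_mean_integrand_continuous:
  fixes H :: "real \<Rightarrow> real"
  assumes "0 < b" "continuous_on {0..1} H"
  shows "continuous_on ({0..1} \<times> {0..1}) (\<lambda>(s, \<tau>). \<tau> powr b * H (s * \<tau>))"
proof -
  have "continuous_on ({0..1} \<times> {0..1}) (\<lambda>z::real\<times>real. H (fst z * snd z))"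
    by (rule continuous_on_compose2[OF assms(2)])
      (auto intro!: continuous_intros simp: mult_le_one)
  moreover have "continuous_on ({0..1} \<times> {0..1}) (\<lambda>z::real\<times>real. snd z powr b)"
    using assms(1) by (intro continuous_on_powr') (auto intro!: continuous_intros)
  ultimately show ?thesis by (simp add: case_prod_unfold continuous_on_mult)
qed

lemma radial_mean_integrable:
  fixes H :: "real \<Rightarrow> real"
  assumes "0 < b" "continuous_on {0..1} H" "s \<in> {0..1}"
  shows "(\<lambda>\<tau>. \<tau> powr b * H (s * \<tau>)) integrable_on {0..1}"
proof (rule integrable_continuous_real)
  have "continuous_on {0..1} (\<lambda>\<tau>. case (s, \<tau>) of (s, \<tau>) \<Rightarrow> \<tau> powr b * H (s * \<tau>))"
    by (rule continuous_on_compose2[OF radial_mean_integrand_continuous[OF assms(1,2)]])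
      (use assms(3) in \<open>auto intro!: continuous_intros\<close>)
  then show "continuous_on {0..1} (\<lambda>\<tau>. \<tau> powr b * H (s * \<tau>))" by simp
qed

lemma continuous_on_radial_mean:
  assumes "0 < b" "continuous_on {0..1} H"
  shows "continuous_on {0..1} (radial_mean b H)"
  using integral_continuous_on_param[of "{0..1}" 0 "1::real" "\<lambda>s \<tau>. \<tau> powr b * H (s * \<tau>)"]
    radial_mean_integrand_continuous[OF assms]
  by (simp add: radial_mean_def[abs_def])

text \<open>Differentiation under the integral sign produces a further factor \<open>\<tau>\<close>,
  which raises \<open>b\<close> by one. The smoothness induction in
  \<open>C_k_real_radial_mean\<close> therefore lets \<open>b\<close> vary.\<close>

lemma DERIV_radial_mean:
  assumes b: "0 < b" and H: "\<And>s. s \<in> {0..1} \<Longrightarrow> (H has_real_derivative H' s) (at s within {0..1})"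
    and H': "continuous_on {0..1} H'" and s: "s \<in> {0..1}"
  shows "(radial_mean b H has_real_derivative radial_mean (b + 1) H' s) (at s within {0..1})"
proof -
  have cH: "continuous_on {0..1} H" using H by (rule DERIV_continuous_on)
  have "((\<lambda>s. integral (cbox 0 1) (\<lambda>\<tau>. \<tau> powr b * H (s * \<tau>))) has_field_derivative
      integral (cbox 0 1) (\<lambda>\<tau>. \<tau> powr (b + 1) * H' (s * \<tau>))) (at s within {0..1})"
  proof (rule leibniz_rule_field_derivative)
    fix s \<tau> :: real assume s: "s \<in> {0..1}" and \<tau>: "\<tau> \<in> cbox 0 1"
    have "(H has_real_derivative H' (s * \<tau>)) (at (s * \<tau>) within (\<lambda>s. s * \<tau>) ` {0..1})"
      using s \<tau> by (intro DERIV_subset[OF H]) (auto simp: mult_le_one)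
    moreover have "((\<lambda>s. s * \<tau>) has_real_derivative \<tau>) (at s within {0..1})"
      by (auto intro!: derivative_eq_intros)
    ultimately have "((\<lambda>s. H (s * \<tau>)) has_real_derivative H' (s * \<tau>) * \<tau>) (at s within {0..1})"
      using DERIV_image_chain[of H "H' (s * \<tau>)" "\<lambda>s. s * \<tau>"] by (simp add: o_def)
    then have "((\<lambda>s. \<tau> powr b * H (s * \<tau>)) has_real_derivative \<tau> powr b * (H' (s * \<tau>) * \<tau>)) (at s within {0..1})"
      by (rule DERIV_cmult)
    moreover have "\<tau> powr (b + 1) = \<tau> powr b * \<tau>"
      using \<tau> by (cases "\<tau> = 0") (auto simp: powr_add)
    ultimately show "((\<lambda>s. \<tau> powr b * H (s * \<tau>)) has_real_derivative \<tau> powr (b + 1) * H' (s * \<tau>)) (at s within {0..1})"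
      by (simp add: mult_ac)
  next
    show "(\<lambda>\<tau>. \<tau> powr b * H (s * \<tau>)) integrable_on cbox 0 1" if "s \<in> {0..1}" for s
      using radial_mean_integrable[OF b cH that] by simp
    show "continuous_on ({0..1} \<times> cbox 0 1) (\<lambda>(s, \<tau>). \<tau> powr (b + 1) * H' (s * \<tau>))"
      using radial_mean_integrand_continuous[of "b + 1" H'] b H' by simp
  qed (use s in auto)
  then show ?thesis by (simp add: radial_mean_def[abs_def])
qed

lemma C_k_real_radial_mean:
  "0 < b \<Longrightarrow> C_k_real k {0..1} H \<Longrightarrow> C_k_real k {0..1} (radial_mean b H)"
proof (induction k arbitrary: b H)
  case 0 then show ?case by (simp add: continuous_on_radial_mean)
next
  case (Suc k)
  then obtain H' where H': "\<And>s. s \<in> {0..1} \<Longrightarrow> (H has_real_derivative H' s) (at s within {0..1})"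
    "C_k_real k {0..1} H'" unfolding C_k_real.simps by blast
  have "C_k_real k {0..1} (radial_mean (b + 1) H')"
    using Suc.prems(1) by (intro Suc.IH H'(2)) simp
  then show ?case
    using DERIV_radial_mean[OF Suc.prems(1) H'(1) C_k_real_imp_continuous[OF H'(2)]]
    unfolding C_k_real.simps by blast
qed

text \<open>Substitute \<open>\<sigma> = s * \<tau>\<close>.\<close>

lemma radial_mean_flux:
  assumes "0 < b" "continuous_on {0..1} H" "s \<in> {0<..1}"
  shows "s powr (b + 1) * radial_mean b H s = integral {0..s} (\<lambda>\<sigma>. \<sigma> powr b * H \<sigma>)"
proof -
  have "(\<lambda>x. x / s) ` {0..s} = {0..1}"
    using assms(3) by (auto simp: image_iff intro!: bexI[of _ "_ * s"] simp: mult_le_cancel_right1)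
  then have "integral {0..1} (\<lambda>\<tau>. (s * \<tau>) powr b * H (s * \<tau>)) = 1 / s * integral {0..s} (\<lambda>\<sigma>. \<sigma> powr b * H \<sigma>)"
    using integral_stretch_real[of s 0 s "\<lambda>\<sigma>. \<sigma> powr b * H \<sigma>"] assms(3) by simp
  moreover have "integral {0..1} (\<lambda>\<tau>. (s * \<tau>) powr b * H (s * \<tau>)) = s powr b * radial_mean b H s"
  proof -
    have "integral {0..1} (\<lambda>\<tau>. (s * \<tau>) powr b * H (s * \<tau>))
        = integral {0..1} (\<lambda>\<tau>. s powr b * (\<tau> powr b * H (s * \<tau>)))"
      using assms(3) by (intro integral_cong) (auto simp: powr_mult)
    then show ?thesis by (simp add: radial_mean_def)
  qed
  ultimately show ?thesis
    using assms(3) by (simp add: powr_add field_simps)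
qed

lemma DERIV_radial_mean_flux:
  assumes b: "0 < b" and H: "continuous_on {0..1} H" and s: "s \<in> {0<..<1}"
  shows "((\<lambda>s. s powr (b + 1) * radial_mean b H s) has_real_derivative s powr b * H s) (at s)"
proof -
  have c: "continuous_on {0..1} (\<lambda>\<sigma>. \<sigma> powr b * H \<sigma>)"
    using b H by (intro continuous_on_mult continuous_on_powr') (auto intro!: continuous_intros)
  have "((\<lambda>s. integral {0..s} (\<lambda>\<sigma>. \<sigma> powr b * H \<sigma>)) has_real_derivative s powr b * H s) (at s within {0<..<1})"
    using s by (intro DERIV_subset[OF integral_has_real_derivative[OF c]]) auto
  then have "((\<lambda>s. integral {0..s} (\<lambda>\<sigma>. \<sigma> powr b * H \<sigma>)) has_real_derivative s powr b * H s) (at s)"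
    using s at_within_open[OF s] by simp
  then show ?thesis
    by (rule has_field_derivative_transform_within_open[OF _ _ s]) (auto simp: radial_mean_flux[OF b H])
qed

lemma radial_mean_zero:
  assumes "0 < b" shows "radial_mean b H 0 = H 0 / (b + 1)"
proof -
  have "((\<lambda>\<tau>. \<tau> powr b) has_integral (1 powr (b + 1) / (b + 1))) {0..1::real}"
    using has_integral_powr_from_0[of b 1] assms by simp
  then show ?thesis by (simp add: radial_mean_def integral_unique)
qed

text \<open>Expand the derivative of the flux by the product rule and divide by
  \<open>s powr b\<close>. In this form, free of powers of \<open>s\<close>, the radial equation
  also holds at \<open>s = 0\<close>, where the mean is that of the constant
  \<open>H 0\<close>.\<close>

lemma radial_mean_euler:
  assumes b: "0 < b" and H: "\<And>s. s \<in> {0..1} \<Longrightarrow> (H has_real_derivative H' s) (at s within {0..1})"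
    and H': "continuous_on {0..1} H'" and s: "s \<in> {0..<1}"
  shows "s * radial_mean (b + 1) H' s + (b + 1) * radial_mean b H s = H s"
proof (cases "s = 0")
  case True
  then show ?thesis using b by (simp add: radial_mean_zero)
next
  case False
  then have s': "s \<in> {0<..<1}" using s by auto
  have cH: "continuous_on {0..1} H" using H by (rule DERIV_continuous_on)
  have "(radial_mean b H has_real_derivative radial_mean (b + 1) H' s) (at s within {0<..<1})"
    using s' by (intro DERIV_subset[OF DERIV_radial_mean[OF b H H']]) auto
  then have "(radial_mean b H has_real_derivative radial_mean (b + 1) H' s) (at s)"
    unfolding at_within_open[OF s' open_greaterThanLessThan] .
  moreover have "((\<lambda>s. s powr (b + 1)) has_real_derivative (b + 1) * s powr b) (at s)"
    using s' by (auto intro!: derivative_eq_intros)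
  ultimately have "((\<lambda>s. s powr (b + 1) * radial_mean b H s) has_real_derivative
      (b + 1) * s powr b * radial_mean b H s + radial_mean (b + 1) H' s * s powr (b + 1)) (at s)"
    by (rule DERIV_mult[rotated])
  from DERIV_unique[OF this DERIV_radial_mean_flux[OF b cH s']]
  have "s powr b * (s * radial_mean (b + 1) H' s + (b + 1) * radial_mean b H s) = s powr b * H s"
    using s' by (simp add: powr_add algebra_simps)
  then show ?thesis using s' by simp
qed

lemma radial_mean_add:
  assumes "0 < b" "continuous_on {0..1} H" "continuous_on {0..1} G" "s \<in> {0..1}"
  shows "radial_mean b (\<lambda>s. H s + G s) s = radial_mean b H s + radial_mean b G s"
  unfolding radial_mean_def
  using integral_add[OF radial_mean_integrable[OF assms(1,2,4)] radial_mean_integrable[OF assms(1,3,4)]]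
  by (simp add: distrib_left)

lemma radial_mean_const: "0 < b \<Longrightarrow> radial_mean b (\<lambda>s. c) s = c / (b + 1)"
  using radial_mean_zero[of b "\<lambda>s. c"] by (simp add: radial_mean_def)

section \<open>The Green operator\<close>

lemma C_k_real_cong:
  assumes "\<And>s. s \<in> T \<Longrightarrow> F s = G s"
  shows "C_k_real k T F = C_k_real k T G"
proof (cases k)
  case 0
  then show ?thesis using assms by (simp cong: continuous_on_cong)
next
  case (Suc m)
  have "(F has_real_derivative D) (at s within T) = (G has_real_derivative D) (at s within T)"
    if "s \<in> T" for s D
    using has_field_derivative_cong_eventually[of F G s T D] assms that
    by (auto simp: eventually_at_filter)
  then show ?thesis unfolding Suc C_k_real.simps by blast
qed

definition primitive :: "(real \<Rightarrow> real) \<Rightarrow> real \<Rightarrow> real" where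
  "primitive H s = integral {0..s} H"

lemma DERIV_primitive:
  "continuous_on {0..1} H \<Longrightarrow> s \<in> {0..1} \<Longrightarrow>
    (primitive H has_real_derivative H s) (at s within {0..1})"
  unfolding primitive_def[abs_def] by (rule integral_has_real_derivative)

lemma continuous_on_primitive: "continuous_on {0..1} H \<Longrightarrow> continuous_on {0..1} (primitive H)"
  using DERIV_primitive by (rule DERIV_continuous_on)

lemma C_k_real_primitive: "C_k_real k {0..1} H \<Longrightarrow> C_k_real (Suc k) {0..1} (primitive H)"
  using DERIV_primitive[OF C_k_real_imp_continuous] unfolding C_k_real.simps by blast

text \<open>The additive constants are chosen such that \<open>green b H\<close> and its derivative vanish at \<open>1\<close>.\<close>

definition green_laplacian :: "real \<Rightarrow> (real \<Rightarrow> real) \<Rightarrow> real \<Rightarrow> real" where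
  "green_laplacian b H s =
     primitive (radial_mean b H) s + - (b + 1) * radial_mean b (primitive (radial_mean b H)) 1"

definition green :: "real \<Rightarrow> (real \<Rightarrow> real) \<Rightarrow> real \<Rightarrow> real" where
  "green b H s = primitive (radial_mean b (green_laplacian b H)) s
     + - primitive (radial_mean b (green_laplacian b H)) 1"

lemma C_k_real_green_laplacian:
  "0 < b \<Longrightarrow> C_k_real k {0..1} H \<Longrightarrow> C_k_real (Suc k) {0..1} (green_laplacian b H)"
  unfolding green_laplacian_def[abs_def]
  by (intro C_k_real_add C_k_real_const C_k_real_primitive C_k_real_radial_mean)

lemma C_k_real_green:
  "0 < b \<Longrightarrow> C_k_real k {0..1} H \<Longrightarrow> C_k_real (Suc (Suc k)) {0..1} (green b H)"
  unfolding green_def[abs_def]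
  by (intro C_k_real_add C_k_real_const C_k_real_primitive C_k_real_radial_mean C_k_real_green_laplacian)

lemma continuous_on_green_laplacian:
  "0 < b \<Longrightarrow> continuous_on {0..1} H \<Longrightarrow> continuous_on {0..1} (green_laplacian b H)"
  using C_k_real_imp_continuous[OF C_k_real_green_laplacian[of b 0 H]] by simp

lemma continuous_on_green: "0 < b \<Longrightarrow> continuous_on {0..1} H \<Longrightarrow> continuous_on {0..1} (green b H)"
  using C_k_real_imp_continuous[OF C_k_real_green[of b 0 H]] by simp

lemma DERIV_green_laplacian:
  assumes "0 < b" "continuous_on {0..1} H" "s \<in> {0..1}"
  shows "(green_laplacian b H has_real_derivative radial_mean b H s) (at s within {0..1})"
  unfolding green_laplacian_def[abs_def]
  by (rule DERIV_cong[OF DERIV_add[OF DERIV_primitive[OF continuous_on_radial_mean[OF assms(1,2)]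
          assms(3)] DERIV_const]]) simp

lemma DERIV_green:
  assumes "0 < b" "continuous_on {0..1} H" "s \<in> {0..1}"
  shows "(green b H has_real_derivative radial_mean b (green_laplacian b H) s) (at s within {0..1})"
  unfolding green_def[abs_def]
  by (rule DERIV_cong[OF DERIV_add[OF DERIV_primitive[OF continuous_on_radial_mean[OF assms(1)
          continuous_on_green_laplacian[OF assms(1,2)]] assms(3)] DERIV_const]]) simp

lemma green_boundary [simp]: "green b H 1 = 0"
  by (simp add: green_def)

text \<open>The mean of a constant \<open>c\<close> is \<open>c / (b + 1)\<close>, which the factor
  \<open>b + 1\<close> in \<open>green_laplacian\<close> compensates.\<close>

lemma green_boundary_deriv:
  assumes "0 < b" "continuous_on {0..1} H"
  shows "radial_mean b (green_laplacian b H) 1 = 0"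
proof -
  have "continuous_on {0..1} (primitive (radial_mean b H))"
    using assms by (intro continuous_on_primitive continuous_on_radial_mean)
  then show ?thesis
    unfolding green_laplacian_def[abs_def] using assms(1)
    by (subst radial_mean_add) (auto simp: radial_mean_const divide_simps algebra_simps)
qed

lemma powr_mult_tendsto_0:
  assumes "0 < a" "continuous_on {0..1} p"
  shows "((\<lambda>s::real. s powr a * p s) \<longlongrightarrow> 0) (at_right 0)"
proof -
  have "continuous_on {0..1} (\<lambda>s::real. s powr a * p s)"
    using assms by (intro continuous_on_mult continuous_on_powr') (auto intro!: continuous_intros)
  then have "((\<lambda>s::real. s powr a * p s) \<longlongrightarrow> 0 powr a * p 0) (at 0 within {0..1})"
    unfolding continuous_on_def by (rule bspec) simp
  then show ?thesis by (simp add: at_within_Icc_at_right)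
qed

lemma has_real_derivative_inside_unit:
  assumes "\<And>s. s \<in> {0..1} \<Longrightarrow> (F has_real_derivative F' s) (at s within {0..1})" "s \<in> {0<..<1}"
  shows "(F has_real_derivative F' s) (at s)"
proof -
  have "(F has_real_derivative F' s) (at s within {0<..<1})"
    using assms by (intro DERIV_subset[OF assms(1)]) auto
  then show ?thesis unfolding at_within_open[OF assms(2) open_greaterThanLessThan] .
qed

lemma green_bilaplace:
  assumes b: "0 < b" and H: "continuous_on {0..1} H"
  shows "radial_bilaplace (b + 1) 1 (green b H) (radial_mean b (green_laplacian b H)) H"
proof (rule radial_bilaplaceI[where L = "green_laplacian b H" and q = "radial_mean b H"])
  note cL = continuous_on_green_laplacian[OF b H]
  have c: "continuous_on {0..1} (radial_mean b (green_laplacian b H))" "continuous_on {0..1} (radial_mean b H)"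
    using b H cL by (auto intro: continuous_on_radial_mean)
  show "continuous_on {0..1} (green b H)" using continuous_on_green[OF b H] .
  show "continuous_on {0<..1} (radial_mean b (green_laplacian b H))"
    by (rule continuous_on_subset[OF c(1)]) auto
  show "((\<lambda>s. s powr (b + 1) * radial_mean b (green_laplacian b H) s) \<longlongrightarrow> 0) (at_right 0)"
    "((\<lambda>s. s powr (b + 1) * radial_mean b H s) \<longlongrightarrow> 0) (at_right 0)"
    using b c by (auto intro!: powr_mult_tendsto_0)
  fix s :: real assume s: "s \<in> {0<..<1}"
  show "(green b H has_real_derivative radial_mean b (green_laplacian b H) s) (at s)"
    by (rule has_real_derivative_inside_unit[OF DERIV_green[OF b H] s])
  show "(green_laplacian b H has_real_derivative radial_mean b H s) (at s)"
    by (rule has_real_derivative_inside_unit[OF DERIV_green_laplacian[OF b H] s])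
  show "((\<lambda>s. s powr (b + 1) * radial_mean b (green_laplacian b H) s) has_real_derivative
      s powr (b + 1 - 1) * green_laplacian b H s) (at s)"
    "((\<lambda>s. s powr (b + 1) * radial_mean b H s) has_real_derivative s powr (b + 1 - 1) * H s) (at s)"
    using DERIV_radial_mean_flux[OF b cL s] DERIV_radial_mean_flux[OF b H s] by simp_all
qed

lemma green_nonneg:
  assumes "0 < b" "continuous_on {0..1} H" "\<And>s. s \<in> {0..1} \<Longrightarrow> 0 \<le> H s" "s \<in> {0..1}"
  shows "0 \<le> green b H s"
  using radial_boggio(2)[OF green_bilaplace[OF assms(1,2)], of s 1] assms
  by (simp add: green_boundary_deriv)

text \<open>Boggio's principle is applied on the unit ball to the difference of the two profiles,
  which has zero boundary data.\<close>

lemma green_mono: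
  assumes "0 < b" "continuous_on {0..1} H" "continuous_on {0..1} G"
    "\<And>s. s \<in> {0..1} \<Longrightarrow> H s \<le> G s" "s \<in> {0..1}"
  shows "green b H s \<le> green b G s"
  using radial_boggio(2)[OF radial_bilaplace_diff[OF green_bilaplace[OF assms(1,3)]
        green_bilaplace[OF assms(1,2)]], of s 1] assms
  by (simp add: green_boundary_deriv)

section \<open>Uniform bounds and limits under the integral operators\<close>

lemma radial_mean_abs_le:
  assumes b: "0 < b" and H: "continuous_on {0..1} H" "\<And>s. s \<in> {0..1} \<Longrightarrow> \<bar>H s\<bar> \<le> M" and s: "s \<in> {0..1}"
  shows "\<tau> \<in> {0..1} \<Longrightarrow> \<bar>\<tau> powr b * H (s * \<tau>)\<bar> \<le> M" and "\<bar>radial_mean b H s\<bar> \<le> M"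
proof -
  show le: "\<bar>\<tau> powr b * H (s * \<tau>)\<bar> \<le> M" if "\<tau> \<in> {0..1}" for \<tau>
  proof -
    have "\<tau> powr b \<le> 1" using that b by (intro powr_le1) auto
    then have "\<tau> powr b * \<bar>H (s * \<tau>)\<bar> \<le> 1 * M"
      using H(2)[OF mult_in_unit[OF s that]] by (intro mult_mono) auto
    then show ?thesis by (simp add: abs_mult)
  qed
  show "\<bar>radial_mean b H s\<bar> \<le> M"
    using integral_norm_bound_integral[OF radial_mean_integrable[OF b H(1) s]
        integrable_const_ivl[of M 0 1]] le
    by (simp add: radial_mean_def)
qed

lemma primitive_abs_le:
  assumes "continuous_on {0..1} H" "\<And>s. s \<in> {0..1} \<Longrightarrow> \<bar>H s\<bar> \<le> M" and s: "s \<in> {0..1}"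
  shows "\<bar>primitive H s\<bar> \<le> M"
proof -
  have "H integrable_on {0..s}"
    using s by (intro integrable_continuous_real continuous_on_subset[OF assms(1)]) auto
  then have "norm (integral {0..s} H) \<le> integral {0..s} (\<lambda>_. M)"
    using s assms(2) by (intro integral_norm_bound_integral integrable_const_ivl) auto
  also have "\<dots> \<le> M" using s assms(2)[OF s] by (simp add: mult_left_le_one_le)
  finally show ?thesis by (simp add: primitive_def)
qed

text \<open>Means and primitives on the unit interval preserve the bound \<open>M\<close>, and the
  additive constant in \<open>green_laplacian\<close> contributes \<open>(b + 1) * M\<close>. This
  later makes the iterates uniformly Lipschitz.\<close>

lemma green_deriv_abs_le:
  assumes b: "0 < b" and H: "continuous_on {0..1} H" "\<And>s. s \<in> {0..1} \<Longrightarrow> \<bar>H s\<bar> \<le> M" and s: "s \<in> {0..1}"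
  shows "\<bar>radial_mean b (green_laplacian b H) s\<bar> \<le> (b + 2) * M"
proof (rule radial_mean_abs_le(2)[OF b continuous_on_green_laplacian[OF b H(1)] _ s])
  fix s :: real assume s: "s \<in> {0..1}"
  note c = continuous_on_radial_mean[OF b H(1)]
  have 1: "\<bar>primitive (radial_mean b H) s\<bar> \<le> M" if "s \<in> {0..1}" for s
    by (rule primitive_abs_le[OF c radial_mean_abs_le(2)[OF b H] that])
  have 2: "\<bar>radial_mean b (primitive (radial_mean b H)) 1\<bar> \<le> M"
    by (rule radial_mean_abs_le(2)[OF b continuous_on_primitive[OF c] 1]) auto
  have "\<bar>green_laplacian b H s\<bar> \<le> \<bar>primitive (radial_mean b H) s\<bar>
      + \<bar>- (b + 1) * radial_mean b (primitive (radial_mean b H)) 1\<bar>"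
    unfolding green_laplacian_def by (rule abs_triangle_ineq)
  also have "\<dots> \<le> M + (b + 1) * M"
    unfolding abs_mult using 1[OF s] 2 b by (intro add_mono mult_mono) auto
  finally show "\<bar>green_laplacian b H s\<bar> \<le> (b + 2) * M" by (simp add: algebra_simps)
qed

text \<open>This mode of convergence passes through means and primitives by dominated convergence,
  hence through \<open>green\<close>. Continuity of the limit is required separately because
  pointwise convergence does not provide it.\<close>

definition bounded_limit :: "(nat \<Rightarrow> real \<Rightarrow> real) \<Rightarrow> (real \<Rightarrow> real) \<Rightarrow> bool" where
  "bounded_limit F f \<longleftrightarrow> (\<exists>M. \<forall>n. \<forall>s\<in>{0..1}. \<bar>F n s\<bar> \<le> M) \<and> (\<forall>n. continuous_on {0..1} (F n)) \<and>
     continuous_on {0..1} f \<and> (\<forall>s\<in>{0..1}. (\<lambda>n. F n s) \<longlonglongrightarrow> f s)"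

lemma bounded_limit_radial_mean:
  assumes b: "0 < b" and F: "bounded_limit F f"
  shows "bounded_limit (\<lambda>n. radial_mean b (F n)) (radial_mean b f)"
proof -
  obtain M where M: "\<And>n s. s \<in> {0..1} \<Longrightarrow> \<bar>F n s\<bar> \<le> M" using F unfolding bounded_limit_def by blast
  have c: "\<And>n. continuous_on {0..1} (F n)" "continuous_on {0..1} f"
    and lim: "\<And>s. s \<in> {0..1} \<Longrightarrow> (\<lambda>n. F n s) \<longlonglongrightarrow> f s"
    using F unfolding bounded_limit_def by blast+
  have "(\<lambda>n. radial_mean b (F n) s) \<longlonglongrightarrow> radial_mean b f s" if s: "s \<in> {0..1}" for s
    unfolding radial_mean_def
  proof (rule dominated_convergence(2)[where h = "\<lambda>_. M"])
    show "(\<lambda>\<tau>. \<tau> powr b * F k (s * \<tau>)) integrable_on {0..1}" for k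
      by (rule radial_mean_integrable[OF b c(1) s])
    show "norm (\<tau> powr b * F k (s * \<tau>)) \<le> M" if "\<tau> \<in> {0..1}" for k \<tau>
      using radial_mean_abs_le(1)[OF b c(1) M s that] by simp
    show "(\<lambda>k. \<tau> powr b * F k (s * \<tau>)) \<longlonglongrightarrow> \<tau> powr b * f (s * \<tau>)" if "\<tau> \<in> {0..1}" for \<tau>
      by (intro tendsto_mult_left lim mult_in_unit s that)
  qed (rule integrable_const_ivl)
  moreover have "\<bar>radial_mean b (F n) s\<bar> \<le> M" if "s \<in> {0..1}" for n s
    by (rule radial_mean_abs_le(2)[OF b c(1) M that])
  ultimately show ?thesis
    unfolding bounded_limit_def using continuous_on_radial_mean[OF b] c by blast
qed

lemma bounded_limit_primitive:
  assumes F: "bounded_limit F f"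
  shows "bounded_limit (\<lambda>n. primitive (F n)) (primitive f)"
proof -
  obtain M where M: "\<And>n s. s \<in> {0..1} \<Longrightarrow> \<bar>F n s\<bar> \<le> M" using F unfolding bounded_limit_def by blast
  have c: "\<And>n. continuous_on {0..1} (F n)" "continuous_on {0..1} f"
    and lim: "\<And>s. s \<in> {0..1} \<Longrightarrow> (\<lambda>n. F n s) \<longlonglongrightarrow> f s"
    using F unfolding bounded_limit_def by blast+
  have int: "F n integrable_on {0..s}" if "s \<in> {0..1}" for n s
    using that by (intro integrable_continuous_real continuous_on_subset[OF c(1)]) auto
  have "(\<lambda>n. primitive (F n) s) \<longlonglongrightarrow> primitive f s" if s: "s \<in> {0..1}" for s
    unfolding primitive_def
  proof (rule dominated_convergence(2)[where h = "\<lambda>_. M"])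
    show "F k integrable_on {0..s}" for k by (rule int[OF s])
    show "norm (F k \<tau>) \<le> M" if "\<tau> \<in> {0..s}" for k \<tau>
      using M[of \<tau> k] that s by simp
    show "(\<lambda>k. F k \<tau>) \<longlonglongrightarrow> f \<tau>" if "\<tau> \<in> {0..s}" for \<tau>
      using that s by (intro lim) auto
  qed (rule integrable_const_ivl)
  moreover have "\<bar>primitive (F n) s\<bar> \<le> M" if "s \<in> {0..1}" for n s
    by (rule primitive_abs_le[OF c(1) M that])
  ultimately show ?thesis
    unfolding bounded_limit_def using continuous_on_primitive c by blast
qed

lemma bounded_limit_add_const:
  assumes F: "bounded_limit F f" and d: "d \<longlonglongrightarrow> d'"
  shows "bounded_limit (\<lambda>n s. F n s + d n) (\<lambda>s. f s + d')"
proof -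
  obtain M where M: "\<And>n s. s \<in> {0..1} \<Longrightarrow> \<bar>F n s\<bar> \<le> M" using F unfolding bounded_limit_def by blast
  have "Bseq d" using d by (intro convergent_imp_Bseq convergentI)
  then obtain K where K: "\<And>n. \<bar>d n\<bar> \<le> K" by (auto simp: Bseq_def)
  have "\<bar>F n s + d n\<bar> \<le> M + K" if "s \<in> {0..1}" for n s
    using M[OF that, of n] K[of n] by linarith
  then have "\<exists>M. \<forall>n. \<forall>s\<in>{0..1}. \<bar>F n s + d n\<bar> \<le> M" by blast
  then show ?thesis
    using F d unfolding bounded_limit_def by (auto intro!: continuous_intros tendsto_add)
qed

lemma bounded_limit_green:
  assumes b: "0 < b" and F: "bounded_limit F f"
  shows "bounded_limit (\<lambda>n. radial_mean b (green_laplacian b (F n))) (radial_mean b (green_laplacian b f))"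
    and "bounded_limit (\<lambda>n. green b (F n)) (green b f)"
proof -
  have at1: "(\<lambda>n. G n 1) \<longlonglongrightarrow> g 1" if "bounded_limit G g" for G g
    using that unfolding bounded_limit_def by simp
  have "bounded_limit (\<lambda>n. green_laplacian b (F n)) (green_laplacian b f)"
    unfolding green_laplacian_def[abs_def]
    by (intro bounded_limit_add_const tendsto_mult_left at1 bounded_limit_radial_mean
        bounded_limit_primitive b F)
  then show 1: "bounded_limit (\<lambda>n. radial_mean b (green_laplacian b (F n))) (radial_mean b (green_laplacian b f))"
    by (rule bounded_limit_radial_mean[OF b])
  show "bounded_limit (\<lambda>n. green b (F n)) (green b f)"
    unfolding green_def[abs_def]
    by (intro bounded_limit_add_const tendsto_minus at1 bounded_limit_primitive 1)
qed

text \<open>Vanishing on an interval is inherited along the chain \<open>w\<close>,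
  \<open>p\<close>, \<open>L\<close>, \<open>q\<close>, \<open>h\<close>. This serves the strict
  positivity of solutions: they cannot vanish near the boundary while the right-hand side is
  positive.\<close>

lemma radial_bilaplace_zero:
  assumes w: "radial_bilaplace a R w p h" and z: "\<And>s. s \<in> {r<..<R} \<Longrightarrow> w s = 0" and "0 \<le> r"
    and s: "s \<in> {r<..<R}"
  shows "h s = 0"
proof -
  have zero: "D = 0" if "(G has_real_derivative D) (at s)" "\<And>s. s \<in> {r<..<R} \<Longrightarrow> G s = 0" "s \<in> {r<..<R}"
    for G D and s :: real
  proof -
    have "((\<lambda>_. 0) has_real_derivative D) (at s)"
      by (rule has_field_derivative_transform_within_open[OF that(1) open_greaterThanLessThan that(3,2)])
    then show ?thesis using DERIV_unique DERIV_const by blast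
  qed
  obtain L q where d: "\<And>s. s \<in> {r<..<R} \<Longrightarrow> (w has_real_derivative p s) (at s)"
      "\<And>s. s \<in> {r<..<R} \<Longrightarrow> ((\<lambda>s. s powr a * p s) has_real_derivative s powr (a - 1) * L s) (at s)"
      "\<And>s. s \<in> {r<..<R} \<Longrightarrow> (L has_real_derivative q s) (at s)"
      "\<And>s. s \<in> {r<..<R} \<Longrightarrow> ((\<lambda>s. s powr a * q s) has_real_derivative s powr (a - 1) * h s) (at s)"
    using w \<open>0 \<le> r\<close> unfolding radial_bilaplace_def by force
  have p: "p s = 0" if "s \<in> {r<..<R}" for s using zero[OF d(1) z] that by blast
  have L: "L s = 0" if s: "s \<in> {r<..<R}" for s
    using zero[OF d(2)[OF s] _ s] p s \<open>0 \<le> r\<close> by simp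
  have q: "q s = 0" if "s \<in> {r<..<R}" for s using zero[OF d(3) L] that by blast
  show ?thesis
    using zero[OF d(4)[OF s] _ s] q s \<open>0 \<le> r\<close> by simp
qed

section \<open>Monotone iteration\<close>

lemma inverse_square_mono:
  fixes x y c :: real
  assumes "0 \<le> c" "x \<le> y" "y < 1"
  shows "c / (1 - x)\<^sup>2 \<le> c / (1 - y)\<^sup>2"
  using assms by (intro divide_left_mono power_mono mult_pos_pos) auto

text \<open>Boggio's principle for \<open>w' - w\<close>. Besides the order of the values it yields
  the order of the derivatives at interior radii, which supplies boundary data on smaller
  balls.\<close>

lemma radial_boggio_le:
  assumes w: "radial_bilaplace a R w p h" and w': "radial_bilaplace a R w' p' h'"
    and h: "\<And>s. s \<in> {0<..<R} \<Longrightarrow> h s \<le> h' s" and R: "0 < R" "p' R \<le> p R" "w R \<le> w' R"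
  shows "s \<in> {0<..R} \<Longrightarrow> p' s \<le> p s" and "s \<in> {0..R} \<Longrightarrow> w s \<le> w' s"
proof -
  note d = radial_bilaplace_diff[OF w' w]
  show "p' s \<le> p s" if "s \<in> {0<..R}"
    using radial_boggio(1)[OF d _ _ that] h R by simp
  show "w s \<le> w' s" if "s \<in> {0..R}"
    using radial_boggio(2)[OF d, of s R] h R that by simp
qed

text \<open>The iteration from 0 increases and stays below \<open>U\<close> on the unit ball and
  below \<open>W\<close> up to squared radius \<open>R\<close>. The limit is only placed below
  \<open>U\<close>; the opposite comparison is left to minimality.\<close>

lemma fixed_point_below_barrier:
  fixes U W :: "real \<Rightarrow> real"
  assumes b: "0 < b" and c: "0 < c" and R: "0 < R" "R \<le> 1"
    and U: "radial_bilaplace (b + 1) 1 U pU (\<lambda>s. c / (1 - U s)\<^sup>2)" "U 1 = 0" "pU 1 = 0"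
      "\<And>s. s \<in> {0..1} \<Longrightarrow> U s < 1"
    and W: "radial_bilaplace (b + 1) R W pW hW" "U R \<le> W R" "pW R \<le> pU R"
      "\<And>s. s \<in> {0..R} \<Longrightarrow> W s < 1" "\<And>s. s \<in> {0<..<R} \<Longrightarrow> c / (1 - W s)\<^sup>2 \<le> hW s"
  obtains V where "continuous_on {0..1} V" "\<And>s. s \<in> {0..1} \<Longrightarrow> V s \<le> U s" "\<And>s. s \<in> {0..1} \<Longrightarrow> 0 \<le> V s"
    "\<And>s. s \<in> {0..R} \<Longrightarrow> V s \<le> W s" "\<And>s. s \<in> {0..1} \<Longrightarrow> V s = green b (\<lambda>s. c / (1 - V s)\<^sup>2) s"
proof -
  define f where "f v s = c / (1 - v s)\<^sup>2" for v and s :: real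
  define v where "v n = ((\<lambda>v. green b (f v)) ^^ n) (\<lambda>_. 0)" for n
  have v0: "v 0 = (\<lambda>_. 0)" and vS: "v (Suc n) = green b (f (v n))" for n
    by (simp_all add: v_def)
  have fU: "f U s \<ge> 0" for U s using c by (simp add: f_def)
  have U': "radial_bilaplace (b + 1) 1 U pU (f U)" using U(1) by (simp add: f_def[abs_def])
  have cU: "continuous_on {0..1} U" using U(1) by (simp add: radial_bilaplace_def)
  have cf: "continuous_on {0..1} (f v)" if "continuous_on {0..1} v" "\<And>s. s \<in> {0..1} \<Longrightarrow> v s \<le> U s" for v
    unfolding f_def[abs_def] using that U(4) by (intro continuous_intros) force+
  have U0: "0 \<le> U s" if "s \<in> {0..1}" for s
    using radial_boggio(2)[OF U' fU, of s 1] U(2,3) that by simp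
  have pU: "pU s \<le> 0" if "s \<in> {0<..1}" for s
    using radial_boggio(1)[OF U' fU _ that] U(3) by simp
  have hW: "0 \<le> hW s" if "s \<in> {0<..<R}" for s
    using W(5)[OF that] c by (meson divide_nonneg_nonneg less_imp_le order_trans zero_le_power2)
  \<comment> \<open>The start 0 has to lie below \<open>W\<close>. At \<open>R\<close> the barrier
    inherits \<open>W R >= 0\<close> and \<open>pW R <= 0\<close> from \<open>U\<close>, and
    Boggio's principle carries the sign inward.\<close>
  have W0: "0 \<le> W s" if "s \<in> {0..R}" for s
    using radial_boggio(2)[OF W(1) hW, of s R] W(2,3) pU[of R] U0[of R] R that by simp
  \<comment> \<open>One iteration preserves both bounds. Comparison with \<open>U\<close> on the
    unit ball also orders the derivatives at \<open>R\<close>; together with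
    \<open>pW R <= pU R\<close> this is the boundary condition for the comparison with
    \<open>W\<close> on the smaller ball.\<close>
  have step: "continuous_on {0..1} (green b (f w)) \<and>
      (\<forall>s\<in>{0..1}. 0 \<le> green b (f w) s \<and> green b (f w) s \<le> U s) \<and> (\<forall>s\<in>{0..R}. green b (f w) s \<le> W s)"
    if w: "continuous_on {0..1} w" "\<And>s. s \<in> {0..1} \<Longrightarrow> w s \<le> U s" "\<And>s. s \<in> {0..R} \<Longrightarrow> w s \<le> W s" for w
  proof -
    have cw: "continuous_on {0..1} (f w)" by (rule cf[OF w(1,2)])
    note g = green_bilaplace[OF b cw]
    let ?p = "radial_mean b (green_laplacian b (f w))"
    have fw: "f w s \<le> f U s" if "s \<in> {0<..<1}" for s
      unfolding f_def using that c by (intro inverse_square_mono w(2) U(4)) auto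
    have p1: "pU 1 \<le> ?p 1" "green b (f w) 1 \<le> U 1"
      using U(2,3) green_boundary_deriv[OF b cw] by simp_all
    have 1: "green b (f w) s \<le> U s" if "s \<in> {0..1}" for s
      by (rule radial_boggio_le(2)[OF g U' fw _ p1 that]) simp_all
    have 2: "pU R \<le> ?p R"
      by (rule radial_boggio_le(1)[OF g U' fw _ p1]) (use R in simp_all)
    have 3: "green b (f w) s \<le> W s" if "s \<in> {0..R}" for s
    proof (rule radial_boggio_le(2)[OF radial_bilaplace_restrict[OF g R(2)] W(1) _ R(1) _ _ that])
      fix s assume s: "s \<in> {0<..<R}"
      then have "f w s \<le> c / (1 - W s)\<^sup>2"
        unfolding f_def using c by (intro inverse_square_mono w(3) W(4)) auto
      then show "f w s \<le> hW s" using W(5)[OF s] by linarith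
    next
      show "pW R \<le> ?p R" using 2 W(3) by linarith
      show "green b (f w) R \<le> W R" using 1[of R] W(2) R by simp
    qed
    show ?thesis
      using continuous_on_green[OF b cw] green_nonneg[OF b cw fU] 1 3 by blast
  qed
  have inv: "continuous_on {0..1} (v n) \<and> (\<forall>s\<in>{0..1}. 0 \<le> v n s \<and> v n s \<le> U s) \<and> (\<forall>s\<in>{0..R}. v n s \<le> W s)" for n
  proof (induction n)
    case 0 then show ?case using U0 W0 by (simp add: v0)
  next
    case (Suc n) then show ?case unfolding vS by (intro step) auto
  qed
  have cfv: "continuous_on {0..1} (f (v n))" for n using inv by (intro cf) auto
  have mono: "v n s \<le> v (Suc n) s" if "s \<in> {0..1}" for n s
    using that
  proof (induction n arbitrary: s)
    case 0 then show ?case using inv[of "Suc 0"] by (simp add: v0)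
  next
    case (Suc n)
    have "f (v n) s \<le> f (v (Suc n)) s" if "s \<in> {0..1}" for s
      unfolding f_def using inv[of "Suc n"] U(4)[OF that] c that
      by (intro inverse_square_mono Suc.IH) fastforce+
    then show ?case unfolding vS[of "Suc n"] vS[of n] using Suc.prems
      by (intro green_mono[OF b cfv[of n] cfv[of "Suc n", unfolded vS]]) (auto simp: vS)
  qed
  define V where "V s = lim (\<lambda>n. v n s)" for s
  have lim: "(\<lambda>n. v n s) \<longlonglongrightarrow> V s" if s: "s \<in> {0..1}" for s
  proof -
    have "Bseq (\<lambda>n. v n s)"
      using inv s by (intro BseqI'[of _ "U s"]) auto
    moreover have "incseq (\<lambda>n. v n s)" using mono[OF s] by (rule incseq_SucI)
    ultimately show ?thesis
      unfolding V_def by (metis Bseq_mono_convergent convergent_LIMSEQ_iff incseq_def)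
  qed
  have VU: "V s \<le> U s" "0 \<le> V s" if "s \<in> {0..1}" for s
    using LIMSEQ_le_const2[OF lim[OF that]] LIMSEQ_le_const[OF lim[OF that]] inv that by blast+
  have VW: "V s \<le> W s" if "s \<in> {0..R}" for s
    using LIMSEQ_le_const2[OF lim[of s]] inv that R by auto
  \<comment> \<open>All right-hand sides \<open>f (v n)\<close> are dominated by \<open>f U\<close>,
    which is bounded because \<open>U\<close> is continuous and below 1 on a compact
    interval.\<close>
  obtain K where K: "\<And>s. s \<in> {0..1} \<Longrightarrow> f U s \<le> K"
    using continuous_attains_sup[OF compact_Icc _ cf[OF cU order_refl]] by force
  have fK: "\<bar>f (v n) s\<bar> \<le> K" if s: "s \<in> {0..1}" for n s
  proof -
    have "f (v n) s \<le> f U s"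
      unfolding f_def using c inv s by (intro inverse_square_mono U(4)) auto
    then show ?thesis using K[OF s] fU[of "v n" s] by simp
  qed
  \<comment> \<open>A monotone pointwise limit need not be continuous. The common derivative bound
    gives all iterates the Lipschitz constant \<open>D\<close>, and the limit inherits it.\<close>
  have cV: "continuous_on {0..1} V"
  proof -
    define D where "D = (b + 2) * K"
    have D0: "0 \<le> D" using K[of 0] fU[of U 0] b by (simp add: D_def)
    have D: "\<bar>radial_mean b (green_laplacian b (f (v n))) s\<bar> \<le> D" if "s \<in> {0..1}" for n s
      unfolding D_def by (rule green_deriv_abs_le[OF b cfv fK that])
    have lip: "\<bar>v n s - v n s'\<bar> \<le> D * \<bar>s - s'\<bar>" if "s \<in> {0..1}" "s' \<in> {0..1}" for n s s'
    proof (cases n)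
      case (Suc m)
      show ?thesis
        using field_differentiable_bound[OF convex_real_interval(5) DERIV_green[OF b cfv[of m]] _ that, of D] D
        unfolding Suc vS by simp
    qed (use D0 in \<open>simp add: v0\<close>)
    have "\<bar>V s - V s'\<bar> \<le> D * \<bar>s - s'\<bar>" if "s \<in> {0..1}" "s' \<in> {0..1}" for s s'
      using lip[OF that] by (intro LIMSEQ_le_const2[OF tendsto_rabs[OF tendsto_diff[OF lim lim]]] that) auto
    then have "D-lipschitz_on {0..1} V" using D0 by (simp add: lipschitz_on_def dist_real_def)
    then show ?thesis by (rule lipschitz_on_continuous_on)
  qed
  have bl: "bounded_limit (\<lambda>n. f (v n)) (f V)"
    unfolding bounded_limit_def
  proof (intro conjI exI ballI allI)
    show "continuous_on {0..1} (f V)" by (rule cf[OF cV VU(1)])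
    show "\<And>n s. s \<in> {0..1} \<Longrightarrow> \<bar>f (v n) s\<bar> \<le> K" by (rule fK)
    show "continuous_on {0..1} (f (v n))" for n by (rule cfv)
    show "(\<lambda>n. f (v n) s) \<longlonglongrightarrow> f V s" if "s \<in> {0..1}" for s
      unfolding f_def using VU[OF that] U(4)[OF that]
      by (intro tendsto_intros lim that) auto
  qed
  \<comment> \<open>The shifted sequence tends to \<open>V s\<close> and, as \<open>green\<close>
    respects bounded limits, also to \<open>green b (f V) s\<close>.\<close>
  have "(\<lambda>n. v (Suc n) s) \<longlonglongrightarrow> green b (f V) s" if "s \<in> {0..1}" for s
    using bounded_limit_green(2)[OF b bl] that unfolding vS bounded_limit_def by blast
  then have "V s = green b (f V) s" if "s \<in> {0..1}" for s
    using LIMSEQ_unique[OF LIMSEQ_Suc[OF lim[OF that]]] that by blast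
  then show thesis
    using that[of V] cV VU VW by (simp add: f_def[abs_def])
qed

section \<open>Rotations and radial functions\<close>

lemma has_derivative_rotated:
  fixes u :: "real^'n \<Rightarrow> real"
  assumes "linear Q" "Q ` S \<subseteq> S" "u differentiable_on S" "x \<in> S"
  shows "((\<lambda>x. u (Q x)) has_derivative (\<lambda>w. \<Sum>j\<in>UNIV. Q w $ j * partial_deriv S j u (Q x)))
           (at x within S)"
proof -
  have "(Q has_derivative Q) (at x within S)"
    using assms(1) by (simp add: linear_conv_bounded_linear bounded_linear_imp_has_derivative)
  moreover have "(u has_derivative (\<lambda>v. \<Sum>j\<in>UNIV. v $ j * partial_deriv S j u (Q x)))
      (at (Q x) within Q ` S)"
    using assms by (intro has_derivative_subset[OF has_derivative_partials]) auto
  ultimately show ?thesis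
    using diff_chain_within[of Q Q x S u] by (simp add: o_def)
qed

lemma partial_deriv_rotated:
  fixes u :: "real^'n \<Rightarrow> real"
  assumes "unique_deriv S" "linear Q" "Q ` S \<subseteq> S" "u differentiable_on S" "x \<in> S"
  shows "partial_deriv S i (\<lambda>x. u (Q x)) x =
    (\<Sum>j\<in>UNIV. Q (axis i 1) $ j * partial_deriv S j u (Q x))"
  using partial_derivI[OF assms(1,5) has_derivative_rotated[OF assms(2-5)]] .

lemma C_k_on_rotated:
  fixes u :: "real^'n \<Rightarrow> real"
  assumes "unique_deriv S" "linear Q" "Q ` S \<subseteq> S" "C_k_on k S u"
  shows "C_k_on k S (\<lambda>x. u (Q x))"
  using assms(4)
proof (induction k arbitrary: u)
  case 0
  then show ?case
    using continuous_on_compose2[of S u S Q] assms(3) linear_continuous_on[of Q S]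
    by (simp add: assms(2) linear_linear)
next
  case (Suc k)
  show ?case
    using Suc by (intro C_k_on_SucI[OF assms(1) has_derivative_rotated] C_k_on_sum C_k_on_mult
        C_k_on_const assms) auto
qed

lemma orthogonal_transformation_rows:
  fixes Q :: "real^'n \<Rightarrow> real^'n"
  assumes "orthogonal_transformation Q"
  shows "(\<Sum>i\<in>UNIV. Q (axis i 1) $ j * Q (axis i 1) $ k) = (if j = k then 1 else 0)"
proof -
  have "matrix Q ** transpose (matrix Q) = mat 1"
    using assms orthogonal_transformation_matrix orthogonal_matrix_def by blast
  then have "(matrix Q ** transpose (matrix Q)) $ j $ k = mat 1 $ j $ k" by simp
  then show ?thesis
    by (simp add: matrix_matrix_mult_def transpose_def matrix_def mat_def)
qed

text \<open>Second derivatives transform with two factors from the matrix of \<open>Q\<close>.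
  Summing over \<open>i\<close> leaves only the diagonal terms because the rows of this matrix are
  orthonormal.\<close>

lemma laplacian_rotated:
  fixes u :: "real^'n \<Rightarrow> real"
  assumes S: "unique_deriv S" and Q: "orthogonal_transformation Q" and QS: "Q ` S \<subseteq> S"
    and u: "C_k_on 2 S u" and x: "x \<in> S"
  shows "laplacian S (\<lambda>x. u (Q x)) x = laplacian S u (Q x)"
proof -
  have l: "linear Q" using Q by (simp add: orthogonal_transformation)
  have d: "u differentiable_on S" "\<And>j. partial_deriv S j u differentiable_on S"
    using u by (auto simp: numeral_2_eq_2)
  let ?q = "\<lambda>i j. Q (axis i 1) $ j" and ?P = "\<lambda>j k. partial_deriv S j (partial_deriv S k u) (Q x)"
  have 2: "partial_deriv S i (partial_deriv S i (\<lambda>x. u (Q x))) x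
      = (\<Sum>k\<in>UNIV. ?q i k * (\<Sum>j\<in>UNIV. ?q i j * ?P j k))" for i
  proof -
    have "partial_deriv S i (partial_deriv S i (\<lambda>x. u (Q x))) x =
        partial_deriv S i (\<lambda>x. \<Sum>k\<in>UNIV. ?q i k * partial_deriv S k u (Q x)) x"
      by (rule partial_deriv_cong[OF x]) (rule partial_deriv_rotated[OF S l QS d(1)])
    also have "\<dots> = (\<Sum>k\<in>UNIV. ?q i k * (\<Sum>j\<in>UNIV. ?q i j * ?P j k))"
      by (rule partial_derivI[OF S x])
        (intro has_derivative_sum has_derivative_mult_right has_derivative_rotated l QS d x)
    finally show ?thesis .
  qed
  have "laplacian S (\<lambda>x. u (Q x)) x = (\<Sum>i\<in>UNIV. \<Sum>k\<in>UNIV. \<Sum>j\<in>UNIV. ?q i k * ?q i j * ?P j k)"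
    unfolding laplacian_def 2 by (simp add: sum_distrib_left mult.assoc)
  also have "\<dots> = (\<Sum>k\<in>UNIV. \<Sum>j\<in>UNIV. (\<Sum>i\<in>UNIV. ?q i k * ?q i j) * ?P j k)"
    unfolding sum_distrib_right
    by (rule trans[OF sum.swap], rule sum.cong[OF refl], rule sum.swap)
  also have "\<dots> = laplacian S u (Q x)"
    unfolding orthogonal_transformation_rows[OF Q] laplacian_def
    by (simp add: if_distrib[of "\<lambda>t. t * _"] cong: if_cong)
  finally show ?thesis .
qed

lemma orthogonal_image_ball:
  fixes Q :: "real^'n \<Rightarrow> real^'n"
  assumes "orthogonal_transformation Q"
  shows "Q ` ball 0 1 \<subseteq> ball 0 1" "Q ` cball 0 1 \<subseteq> cball 0 1"
  using assms by (auto simp: orthogonal_transformation_norm)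

lemma classical_solution_rotated:
  fixes u :: "real^'n \<Rightarrow> real" and Q :: "real^'n \<Rightarrow> real^'n"
  assumes u: "classical_solution lam u" and Q: "orthogonal_transformation Q"
  shows "classical_solution lam (\<lambda>x. u (Q x))"
proof -
  have l: "linear Q" using Q by (simp add: orthogonal_transformation)
  have n: "norm (Q x) = norm x" for x using Q by (simp add: orthogonal_transformation_norm)
  note im = orthogonal_image_ball[OF Q]
  let ?B = "ball (0::real^'n) 1"
  have C4: "C_k_on 4 ?B u" and C1: "C_k_on 1 (cball 0 1) u"
    using u by (auto simp: classical_solution_def simp del: C_k_on.simps One_nat_def)
  have "C_k_on 2 ?B (laplacian ?B u)"
  proof -
    have "C_k_on 2 ?B (partial_deriv ?B i (partial_deriv ?B i u))" for i
      using C4 by (simp add: numeral_eq_Suc)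
    then show ?thesis
      unfolding laplacian_def[abs_def] by (intro C_k_on_sum unique_deriv_ball) auto
  qed
  moreover have C2: "C_k_on 2 ?B u" using C4 by (rule C_k_on_mono) simp
  ultimately have "laplacian ?B (laplacian ?B (\<lambda>x. u (Q x))) x = laplacian ?B (laplacian ?B u) (Q x)"
    if "x \<in> ?B" for x
  proof -
    have "laplacian ?B (laplacian ?B (\<lambda>x. u (Q x))) x = laplacian ?B (\<lambda>x. laplacian ?B u (Q x)) x"
      by (rule laplacian_cong[OF that]) (rule laplacian_rotated[OF unique_deriv_ball Q im(1) C2])
    also have "\<dots> = laplacian ?B (laplacian ?B u) (Q x)"
      by (rule laplacian_rotated[OF unique_deriv_ball Q im(1) _ that]) fact
    finally show ?thesis .
  qed
  moreover have "normal_deriv (\<lambda>x. u (Q x)) x = normal_deriv u (Q x)" if x: "x \<in> sphere 0 1" for x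
  proof -
    have d: "u differentiable_on cball 0 1" using C1 by simp
    have xc: "x \<in> cball 0 1" and Qx: "Q x \<in> cball 0 1" using x n by auto
    show ?thesis
      unfolding normal_deriv_def
        frechet_derivative_within_eq[OF unique_deriv_cball xc has_derivative_rotated[OF l im(2) d xc]]
        frechet_derivative_within_eq[OF unique_deriv_cball Qx has_derivative_partials[OF d Qx]] ..
  qed
  moreover have "Q x \<in> ?B" if "x \<in> ?B" for x using that n by simp
  moreover have "Q x \<in> sphere 0 1" if "x \<in> sphere 0 1" for x using that n by simp
  moreover have "C_k_on 4 ?B (\<lambda>x. u (Q x))" "C_k_on 1 (cball 0 1) (\<lambda>x. u (Q x))"
    using C_k_on_rotated[OF unique_deriv_ball l im(1) C4] C_k_on_rotated[OF unique_deriv_cball l im(2) C1] .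
  ultimately show ?thesis
    using u unfolding classical_solution_def by simp
qed

text \<open>A rotation taking \<open>x\<close> to \<open>y\<close> turns \<open>u\<close> into
  another classical solution, so minimality gives \<open>u x <= u y\<close>; the roles of
  \<open>x\<close> and \<open>y\<close> are symmetric.\<close>

lemma minimal_solution_radial:
  fixes u :: "real^'n \<Rightarrow> real"
  assumes "minimal_solution lam u" "x \<in> ball 0 1" "norm x = norm y"
  shows "u x = u y"
proof -
  have le: "u x \<le> u y" if xy: "x \<in> ball 0 1" "norm x = norm y" for x y
  proof -
    obtain Q where Q: "orthogonal_transformation Q" "Q x = y"
      using orthogonal_transformation_exists[OF xy(2)] .
    have "classical_solution lam (\<lambda>x. u (Q x))"
      using classical_solution_rotated[OF _ Q(1)] assms(1)[unfolded minimal_solution_def, THEN conjunct1] by iprover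
    then have "u x \<le> u (Q x)"
      by (rule assms(1)[unfolded minimal_solution_def, THEN conjunct2, rule_format, OF _ xy(1)])
    then show ?thesis using Q(2) by simp
  qed
  have "y \<in> ball 0 1" using assms(2,3) by simp
  then show ?thesis by (intro order_antisym le[OF assms(2,3)] le[OF _ assms(3)[symmetric]])
qed

lemma laplacian_radially_symmetric:
  fixes u :: "real^'n \<Rightarrow> real"
  assumes u: "C_k_on 2 (ball 0 1) u"
    and rad: "\<And>x y. x \<in> ball 0 1 \<Longrightarrow> norm x = norm y \<Longrightarrow> u x = u y"
    and x: "x \<in> ball 0 1" "norm x = norm y"
  shows "laplacian (ball 0 1) u x = laplacian (ball 0 1) u y"
proof -
  obtain Q where Q: "orthogonal_transformation Q" "Q x = y"
    using orthogonal_transformation_exists[OF x(2)] .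
  have "laplacian (ball 0 1) u x = laplacian (ball 0 1) (\<lambda>x. u (Q x)) x"
    by (rule laplacian_cong[OF x(1) rad]) (simp_all add: orthogonal_transformation_norm[OF Q(1)])
  also have "\<dots> = laplacian (ball 0 1) u y"
    using laplacian_rotated[OF unique_deriv_ball Q(1) orthogonal_image_ball(1)[OF Q(1)] u x(1)] Q(2)
    by simp
  finally show ?thesis .
qed

section \<open>Functions of the squared norm in Cartesian coordinates\<close>

lemma has_derivative_norm_squared:
  fixes x :: "real^'n"
  shows "((\<lambda>x. (norm x)\<^sup>2) has_derivative (\<lambda>v. 2 * (x \<bullet> v))) (at x within S)"
  unfolding power2_norm_eq_inner
  using has_derivative_inner[OF has_derivative_ident has_derivative_ident, of x S]
  by (simp add: inner_commute)

lemma has_derivative_radial: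
  fixes x :: "real^'n"
  assumes "(F has_real_derivative F') (at ((norm x)\<^sup>2) within T)"
    and "\<And>y. y \<in> S \<Longrightarrow> (norm y)\<^sup>2 \<in> T"
  shows "((\<lambda>x. F ((norm x)\<^sup>2)) has_derivative (\<lambda>v. 2 * (x \<bullet> v) * F')) (at x within S)"
proof -
  have "(F has_derivative (\<lambda>h. h * F')) (at ((norm x)\<^sup>2) within (\<lambda>x. (norm x)\<^sup>2) ` S)"
  proof (rule has_derivative_subset)
    show "(F has_derivative (\<lambda>h. h * F')) (at ((norm x)\<^sup>2) within T)"
      using assms(1) by (simp add: has_field_derivative_def mult_commute_abs)
  qed (use assms(2) in blast)
  from diff_chain_within[OF has_derivative_norm_squared this] show ?thesis by (simp add: o_def)
qed

lemma C_k_on_radial: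
  fixes S :: "(real^'n) set"
  assumes "unique_deriv S" "\<And>y. y \<in> S \<Longrightarrow> (norm y)\<^sup>2 \<in> T" "C_k_real k T F"
  shows "C_k_on k S (\<lambda>x. F ((norm x)\<^sup>2))"
  using assms(3)
proof (induction k arbitrary: F)
  case 0
  then show ?case
    using assms(2) continuous_on_compose2[of T F S "\<lambda>x. (norm x)\<^sup>2"]
    by (auto simp: continuous_on_norm continuous_on_power)
next
  case (Suc k)
  then obtain F' where F': "\<And>s. s \<in> T \<Longrightarrow> (F has_real_derivative F' s) (at s within T)" "C_k_real k T F'"
    by auto
  have "C_k_on k S (\<lambda>x. 2 * (x $ i) * F' ((norm x)\<^sup>2))" for i
    by (intro C_k_on_mult C_k_on_const C_k_on_component Suc.IH F' assms(1))
  then show ?case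
    by (intro C_k_on_SucI[OF assms(1) has_derivative_radial[OF F'(1)[OF assms(2)] assms(2)]])
      (simp_all add: inner_axis)
qed

text \<open>General \<open>S\<close> and \<open>T\<close> serve two situations: the whole ball, for
  profiles smooth up to \<open>s = 0\<close>, and the punctured ball, for profiles that contain
  \<open>sqrt s\<close>.\<close>

lemma laplacian_radial:
  fixes S :: "(real^'n) set"
  assumes S: "unique_deriv S" "x \<in> S" "\<And>y. y \<in> S \<Longrightarrow> (norm y)\<^sup>2 \<in> T"
    and u: "\<And>y. y \<in> S \<Longrightarrow> u y = F ((norm y)\<^sup>2)"
    and F: "\<And>s. s \<in> T \<Longrightarrow> (F has_real_derivative F1 s) (at s within T)"
      "\<And>s. s \<in> T \<Longrightarrow> (F1 has_real_derivative F2 s) (at s within T)"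
  shows "laplacian S u x = 4 * ((norm x)\<^sup>2 * F2 ((norm x)\<^sup>2) + real CARD('n) / 2 * F1 ((norm x)\<^sup>2))"
proof -
  let ?s = "(norm x)\<^sup>2"
  have 1: "partial_deriv S i u y = 2 * y $ i * F1 ((norm y)\<^sup>2)" if "y \<in> S" for i y
    using partial_deriv_cong[OF that u]
      partial_derivI[OF S(1) that has_derivative_radial[OF F(1)[OF S(3)[OF that]] S(3)]]
    by (simp add: inner_axis)
  have "partial_deriv S i (partial_deriv S i u) x = 2 * F1 ?s + 4 * (x $ i)\<^sup>2 * F2 ?s" for i
  proof -
    have lin: "((\<lambda>y. 2 * y $ i) has_derivative (\<lambda>v. 2 * v $ i)) (at x within S)"
      by (intro has_derivative_mult_right bounded_linear_imp_has_derivative bounded_linear_vec_nth)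
    have "partial_deriv S i (partial_deriv S i u) x = partial_deriv S i (\<lambda>y. 2 * y $ i * F1 ((norm y)\<^sup>2)) x"
      by (rule partial_deriv_cong[OF S(2) 1])
    also have "\<dots> = 2 * x $ i * (2 * (x \<bullet> axis i 1) * F2 ?s) + 2 * (axis i 1 :: real^'n) $ i * F1 ?s"
      by (rule partial_derivI[OF S(1,2) has_derivative_mult[OF lin has_derivative_radial[OF F(2)[OF S(3)[OF S(2)]] S(3)]]])
    finally show ?thesis by (simp add: inner_axis power2_eq_square)
  qed
  moreover have "(\<Sum>i\<in>UNIV. (x $ i)\<^sup>2) = ?s"
    unfolding power2_norm_eq_inner by (simp add: inner_vec_def power2_eq_square)
  moreover have "(\<Sum>i\<in>UNIV. 2 * F1 ?s + 4 * (x $ i)\<^sup>2 * F2 ?s)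
      = 2 * real CARD('n) * F1 ?s + 4 * F2 ?s * (\<Sum>i\<in>UNIV. (x $ i)\<^sup>2)"
    by (simp add: sum.distrib sum_distrib_left mult_ac)
  ultimately show ?thesis
    unfolding laplacian_def by (simp add: algebra_simps)
qed

text \<open>Derivatives within an open set are the ordinary ones, so the set may be shrunk; this
  permits removing the origin.\<close>

lemma laplacian_open_subset:
  assumes "open S" "open S'" "S' \<subseteq> S" "x \<in> S'"
  shows "laplacian S u x = laplacian S' u x"
proof -
  have 1: "partial_deriv S i v y = partial_deriv S' i v y" if "y \<in> S'" for i v y
    unfolding partial_deriv_def at_within_open[OF that assms(2)]
      at_within_open[OF subsetD[OF assms(3) that] assms(1)] ..
  show ?thesis
    unfolding laplacian_def
  proof (rule sum.cong[OF refl])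
    fix i
    have "partial_deriv S i (partial_deriv S i u) x = partial_deriv S' i (partial_deriv S i u) x"
      by (rule 1[OF assms(4)])
    also have "\<dots> = partial_deriv S' i (partial_deriv S' i u) x"
      by (rule partial_deriv_cong[OF assms(4) 1])
    finally show "partial_deriv S i (partial_deriv S i u) x = partial_deriv S' i (partial_deriv S' i u) x" .
  qed
qed

text \<open>Each Laplacian of a function of |x|^2 carries a factor 4, hence the 16 in
  \<open>H\<close>. Two applications of \<open>radial_mean_euler\<close> undo the two averages in
  \<open>green\<close>.\<close>

lemma classical_solution_fixed_point:
  fixes lam :: real
  assumes N: "3 \<le> CARD('n)" and lam: "0 < lam" and cV: "continuous_on {0..1} V"
    and V: "\<And>s. s \<in> {0..1} \<Longrightarrow> 0 \<le> V s" "\<And>s. s \<in> {0..1} \<Longrightarrow> V s < 1"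
    and b: "b = real CARD('n) / 2 - 1" and H: "H = (\<lambda>s. lam / 16 / (1 - V s)\<^sup>2)"
    and fp: "\<And>s. s \<in> {0..1} \<Longrightarrow> V s = green b H s"
  shows "classical_solution lam (\<lambda>x::real^'n. green b H ((norm x)\<^sup>2))"
proof -
  have b0: "0 < b" using N by (simp add: b)
  let ?B = "ball (0::real^'n) 1" and ?g = "green b H" and ?L = "green_laplacian b H"
  have sB: "(norm y)\<^sup>2 \<in> {0..1}" if "y \<in> ?B" for y
    using that by (simp add: power_le_one)
  have sC: "(norm y)\<^sup>2 \<in> {0..1}" if "y \<in> cball (0::real^'n) 1" for y
    using that by (simp add: power_le_one)
  have HC: "C_k_real k {0..1} H" if "C_k_real k {0..1} V" for k
  proof -
    have "C_k_real k {0..1} (\<lambda>s. lam / 16 * (inverse (1 + (- 1) * V s) * inverse (1 + (- 1) * V s)))"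
    proof -
      have "1 + (- 1) * V s \<noteq> 0" if "s \<in> {0..1}" for s using V(2)[OF that] by simp
      then have "C_k_real k {0..1} (\<lambda>s. inverse (1 + (- 1) * V s))"
        by (rule C_k_real_inverse[OF C_k_real_add[OF C_k_real_const C_k_real_mult[OF C_k_real_const that]]])
      then show ?thesis by (intro C_k_real_mult C_k_real_const)
    qed
    moreover have "H = (\<lambda>s. lam / 16 * (inverse (1 + (- 1) * V s) * inverse (1 + (- 1) * V s)))"
      by (rule ext) (simp add: H power2_eq_square inverse_eq_divide)
    ultimately show ?thesis by (simp only:)
  qed
  have VC: "C_k_real k {0..1} V = C_k_real k {0..1} ?g" for k
    by (rule C_k_real_cong[OF fp])
  \<comment> \<open>Bootstrap: \<open>green\<close> gains two derivatives, so continuity of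
    \<open>V\<close> makes \<open>V\<close> and hence \<open>H\<close> of class C^2, and then
    \<open>green b H\<close> of class C^4.\<close>
  have "C_k_real 0 {0..1} V" using cV by simp
  then have H2: "C_k_real (Suc (Suc 0)) {0..1} H"
    by (intro HC) (simp only: VC C_k_real_green[OF b0 HC])
  then have g4: "C_k_real 4 {0..1} ?g"
    using C_k_real_green[OF b0 H2] by (simp only: numeral_eq_Suc pred_numeral_simps BitM.simps eval_nat_numeral)
  have cH: "continuous_on {0..1} H" using H2 by (rule C_k_real_imp_continuous)
  obtain H' where "\<forall>s\<in>{0..1}. (H has_real_derivative H' s) (at s within {0..1})" "C_k_real (Suc 0) {0..1} H'"
    using H2 unfolding C_k_real.simps(2)[of "Suc 0"] by blast
  then have H': "\<And>s. s \<in> {0..1} \<Longrightarrow> (H has_real_derivative H' s) (at s within {0..1})"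
    and cH': "continuous_on {0..1} H'"
    using C_k_real_imp_continuous by blast+
  note L' = DERIV_green_laplacian[OF b0 cH] and cL' = continuous_on_radial_mean[OF b0 cH]
  have N2: "real CARD('n) / 2 = b + 1" by (simp add: b)
  have lap1: "laplacian ?B (\<lambda>x. ?g ((norm x)\<^sup>2)) x = 4 * ?L ((norm x)\<^sup>2)" if x: "x \<in> ?B" for x
  proof -
    have "laplacian ?B (\<lambda>x. ?g ((norm x)\<^sup>2)) x = 4 * ((norm x)\<^sup>2 * radial_mean (b + 1) (radial_mean b H) ((norm x)\<^sup>2)
        + real CARD('n) / 2 * radial_mean b ?L ((norm x)\<^sup>2))"
      by (rule laplacian_radial[OF unique_deriv_ball x sB refl DERIV_green[OF b0 cH] DERIV_radial_mean[OF b0 L' cL']])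
    also have "\<dots> = 4 * ?L ((norm x)\<^sup>2)"
      unfolding N2 using x by (subst radial_mean_euler[OF b0 L' cL']) (auto simp: power_less_one_iff)
    finally show ?thesis .
  qed
  have lap2: "laplacian ?B (laplacian ?B (\<lambda>x. ?g ((norm x)\<^sup>2))) x = lam / (1 - ?g ((norm x)\<^sup>2))\<^sup>2"
    if x: "x \<in> ?B" for x
  proof -
    have "laplacian ?B (laplacian ?B (\<lambda>x. ?g ((norm x)\<^sup>2))) x = laplacian ?B (\<lambda>x. 4 * ?L ((norm x)\<^sup>2)) x"
      by (rule laplacian_cong[OF x lap1])
    also have "\<dots> = 4 * ((norm x)\<^sup>2 * (4 * radial_mean (b + 1) H' ((norm x)\<^sup>2))
        + real CARD('n) / 2 * (4 * radial_mean b H ((norm x)\<^sup>2)))"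
      by (rule laplacian_radial[where F = "\<lambda>s. 4 * ?L s", OF unique_deriv_ball x sB refl DERIV_cmult[OF L']
            DERIV_cmult[OF DERIV_radial_mean[OF b0 H' cH']]])
    also have "\<dots> = 16 * ((norm x)\<^sup>2 * radial_mean (b + 1) H' ((norm x)\<^sup>2)
        + (b + 1) * radial_mean b H ((norm x)\<^sup>2))"
      unfolding N2 by (simp add: algebra_simps)
    also have "\<dots> = 16 * H ((norm x)\<^sup>2)"
      using x by (subst radial_mean_euler[OF b0 H' cH']) (auto simp: power_less_one_iff)
    also have "\<dots> = lam / (1 - ?g ((norm x)\<^sup>2))\<^sup>2"
      using fp[OF sB[OF x]] by (simp add: H)
    finally show ?thesis .
  qed
  have H0: "0 < H s" if "s \<in> {0..1}" for s
    using lam V(2)[OF that] by (simp add: H)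
  \<comment> \<open>The profile is nonincreasing and nonnegative. If it were not positive at
    \<open>s\<close>, it would vanish between \<open>s\<close> and 1, forcing \<open>H\<close> to
    vanish at the midpoint \<open>m\<close>, although \<open>H\<close> is positive.\<close>
  have pos: "0 < ?g s" if s: "s \<in> {0..<1}" for s
  proof (rule ccontr)
    assume neg: "\<not> 0 < ?g s"
    define m where "m = (s + 1) / 2"
    have m: "m \<in> {s<..<1}" "m \<in> {0..1}" using s by (auto simp: m_def)
    have "?g s' = 0" if s': "s' \<in> {s<..<1}" for s'
    proof (rule antisym)
      have "?g s' \<le> ?g s"
        using s s' by (intro radial_boggio(2)[OF green_bilaplace[OF b0 cH] less_imp_le[OF H0]])
          (simp_all add: green_boundary_deriv[OF b0 cH])
      then show "?g s' \<le> 0" using neg by simp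
      show "0 \<le> ?g s'" using V(1)[of s'] fp[of s'] s s' by simp
    qed
    then have "H m = 0"
      using s by (intro radial_bilaplace_zero[OF green_bilaplace[OF b0 cH] _ _ m(1)]) simp_all
    then show False using H0[OF m(2)] by simp
  qed
  have nd: "normal_deriv (\<lambda>x. ?g ((norm x)\<^sup>2)) x = 0" if "x \<in> sphere (0::real^'n) 1" for x
  proof -
    have x: "x \<in> cball 0 1" and n1: "(norm x)\<^sup>2 = 1" using that by auto
    have "(?g has_real_derivative 0) (at ((norm x)\<^sup>2) within {0..1})"
      using DERIV_green[OF b0 cH, of 1] green_boundary_deriv[OF b0 cH] by (simp add: n1)
    from frechet_derivative_within_eq[OF unique_deriv_cball x has_derivative_radial[OF this sC]]
    show ?thesis by (simp add: normal_deriv_def)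
  qed
  have 4: "C_k_on 4 ?B (\<lambda>x. ?g ((norm x)\<^sup>2))"
    by (rule C_k_on_radial[OF unique_deriv_ball sB g4])
  have g1: "C_k_real 1 {0..1} ?g"
    using C_k_real_lower[OF C_k_real_green[of b 0 H]] b0 cH by simp
  have 1: "C_k_on 1 (cball 0 1) (\<lambda>x::real^'n. ?g ((norm x)\<^sup>2))"
    by (rule C_k_on_radial[OF unique_deriv_cball sC g1])
  have "0 < ?g ((norm x)\<^sup>2) \<and> ?g ((norm x)\<^sup>2) < 1" if x: "x \<in> ?B" for x
    using V(2)[OF sB[OF x]] fp[OF sB[OF x]] pos[of "(norm x)\<^sup>2"] x by (simp add: power_less_one_iff)
  then show ?thesis
    unfolding classical_solution_def using 4 1 lap2 nd by simp
qed

text \<open>A radial function is determined by its restriction to one axis. The chain rule for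
  \<open>sqrt\<close> introduces the factor \<open>1 / (2 * sqrt s)\<close>, so the identities are
  stated away from 0 and the origin enters through the limit of the flux.\<close>

lemma radial_flux:
  fixes v :: "real^'n \<Rightarrow> real" and i :: 'n
  defines "B \<equiv> ball (0::real^'n) 1" and "a \<equiv> real CARD('n) / 2"
  defines "D \<equiv> \<lambda>s. partial_deriv B i v (sqrt s *\<^sub>R axis i 1) / (2 * sqrt s)"
  assumes v: "C_k_on 2 B v" and rad: "\<forall>x\<in>B. \<forall>y. norm x = norm y \<longrightarrow> v x = v y"
  shows "s \<in> {0<..<1} \<Longrightarrow> ((\<lambda>s. v (sqrt s *\<^sub>R axis i 1)) has_real_derivative D s) (at s)"
    and "s \<in> {0<..<1} \<Longrightarrow> ((\<lambda>s. s powr a * D s) has_real_derivative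
           s powr (a - 1) * (laplacian B v (sqrt s *\<^sub>R axis i 1) / 4)) (at s)"
    and "2 \<le> CARD('n) \<Longrightarrow> ((\<lambda>s. s powr a * D s) \<longlongrightarrow> 0) (at_right 0)"
proof -
  let ?e = "axis i 1 :: real^'n"
  have line: "((\<lambda>r. w (r *\<^sub>R ?e)) has_real_derivative partial_deriv B i w (r *\<^sub>R ?e)) (at r)"
    if w: "w differentiable_on B" and r: "\<bar>r\<bar> < 1" for w r
  proof -
    have rB: "r *\<^sub>R ?e \<in> B" using r by (simp add: B_def)
    have 1: "(w has_derivative (\<lambda>h. \<Sum>j\<in>UNIV. h $ j * partial_deriv B j w (r *\<^sub>R ?e))) (at (r *\<^sub>R ?e))"
      using has_derivative_partials[OF w rB] at_within_open[OF rB] by (simp add: B_def)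
    have "((\<lambda>r. r *\<^sub>R ?e) has_derivative (\<lambda>r. r *\<^sub>R ?e)) (at r)"
      by (auto intro!: derivative_eq_intros)
    from diff_chain_at[OF this 1] have "((\<lambda>r. w (r *\<^sub>R ?e)) has_derivative
        (\<lambda>h. \<Sum>j\<in>UNIV. (h *\<^sub>R ?e) $ j * partial_deriv B j w (r *\<^sub>R ?e))) (at r)"
      by (simp only: o_def)
    moreover have "(\<Sum>j\<in>UNIV. (h *\<^sub>R ?e) $ j * partial_deriv B j w (r *\<^sub>R ?e)) = partial_deriv B i w (r *\<^sub>R ?e) * h" for h
      by (simp add: axis_def if_distrib[of "\<lambda>t. _ * t * _"] cong: if_cong)
    ultimately show ?thesis by (simp add: has_field_derivative_def)
  qed
  define \<phi>1 where "\<phi>1 r = partial_deriv B i v (r *\<^sub>R ?e)" for r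
  define \<phi>2 where "\<phi>2 r = partial_deriv B i (partial_deriv B i v) (r *\<^sub>R ?e)" for r
  have d: "v differentiable_on B" "partial_deriv B i v differentiable_on B"
    using v by (auto simp: numeral_2_eq_2)
  have D: "D s = \<phi>1 (sqrt s) / (2 * sqrt s)" for s by (simp add: D_def \<phi>1_def)
  have d0: "((\<lambda>s. v (sqrt s *\<^sub>R ?e)) has_real_derivative D s) (at s)" if s: "s \<in> {0<..<1}" for s
  proof -
    have "((\<lambda>s. v (sqrt s *\<^sub>R ?e)) has_real_derivative \<phi>1 (sqrt s) * (inverse (sqrt s) / 2)) (at s)"
      unfolding \<phi>1_def using s by (intro DERIV_chain2[OF line[OF d(1)] DERIV_real_sqrt]) auto
    then show ?thesis by (simp add: D inverse_eq_divide mult_ac)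
  qed
  define D' where "D' s = \<phi>2 (sqrt s) / (4 * s) - \<phi>1 (sqrt s) / (4 * s * sqrt s)" for s
  have d1: "(D has_real_derivative D' s) (at s)" if s: "s \<in> {0<..<1}" for s
  proof -
    have 1: "((\<lambda>s. \<phi>1 (sqrt s)) has_real_derivative \<phi>2 (sqrt s) * (inverse (sqrt s) / 2)) (at s)"
      unfolding \<phi>1_def \<phi>2_def using s by (intro DERIV_chain2[OF line[OF d(2)] DERIV_real_sqrt]) auto
    have 2: "((\<lambda>s. 2 * sqrt s) has_real_derivative inverse (sqrt s)) (at s)"
      using s by (auto intro!: derivative_eq_intros)
    define r where "r = sqrt s"
    have r: "0 < r" "s = r * r" using s by (auto simp: r_def)
    have "(D has_real_derivative (\<phi>2 r * (inverse r / 2) * (2 * r) - \<phi>1 r * inverse r) / (2 * r * (2 * r))) (at s)"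
      unfolding D[abs_def] r_def using s by (intro DERIV_divide[OF 1 2]) auto
    moreover have "(\<phi>2 r * (inverse r / 2) * (2 * r) - \<phi>1 r * inverse r) / (2 * r * (2 * r)) = D' s"
      unfolding D'_def r_def[symmetric] using r(1) by (simp add: r(2) divide_simps)
    ultimately show ?thesis by simp
  qed
  have lap: "laplacian B v (sqrt s *\<^sub>R ?e) / 4 = s * D' s + a * D s" if s: "s \<in> {0<..<1}" for s
  proof -
    \<comment> \<open>\<open>sqrt\<close> is not differentiable at 0, so the radial formula is
      applied on the punctured ball.\<close>
    let ?S = "B - {0}" and ?x = "sqrt s *\<^sub>R ?e"
    have oB: "open B" "open ?S" by (auto simp: B_def)
    have x: "?x \<in> ?S" and nx: "(norm ?x)\<^sup>2 = s" using s by (auto simp: B_def axis_eq_0_iff)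
    have "laplacian B v ?x = laplacian ?S v ?x"
      using x by (intro laplacian_open_subset oB) auto
    also have "\<dots> = 4 * ((norm ?x)\<^sup>2 * D' ((norm ?x)\<^sup>2) + real CARD('n) / 2 * D ((norm ?x)\<^sup>2))"
    proof (rule laplacian_radial[where T = "{0<..<1}" and F = "\<lambda>s. v (sqrt s *\<^sub>R ?e)"])
      show "unique_deriv ?S" using oB(2) by (rule unique_deriv_open)
      show "(norm y)\<^sup>2 \<in> {0<..<1}" if "y \<in> ?S" for y
        using that by (auto simp: B_def power_less_one_iff)
      show "v y = v (sqrt ((norm y)\<^sup>2) *\<^sub>R ?e)" if "y \<in> ?S" for y
        using that by (intro rad[rule_format]) auto
      show "((\<lambda>s. v (sqrt s *\<^sub>R ?e)) has_real_derivative D s) (at s within {0<..<1})"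
        "(D has_real_derivative D' s) (at s within {0<..<1})" if "s \<in> {0<..<1}" for s
        using d0[OF that] d1[OF that] by (auto intro: has_field_derivative_at_within)
    qed (rule x)
    finally show ?thesis unfolding nx a_def by simp
  qed
  show "((\<lambda>s. v (sqrt s *\<^sub>R ?e)) has_real_derivative D s) (at s)" if "s \<in> {0<..<1}"
    using d0[OF that] .
  show "((\<lambda>s. s powr a * D s) has_real_derivative s powr (a - 1) * (laplacian B v (sqrt s *\<^sub>R ?e) / 4)) (at s)"
    if s: "s \<in> {0<..<1}"
  proof -
    have "((\<lambda>s. s powr a) has_real_derivative a * s powr (a - 1)) (at s)"
      using s by (auto intro!: derivative_eq_intros)
    from DERIV_mult[OF this d1[OF s]]
    have "((\<lambda>s. s powr a * D s) has_real_derivative a * s powr (a - 1) * D s + D' s * s powr a) (at s)" .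
    moreover have "s powr a = s powr (a - 1) * s" using s by (simp add: powr_diff)
    ultimately show ?thesis unfolding lap[OF s] by (simp add: algebra_simps)
  qed
  show "((\<lambda>s. s powr a * D s) \<longlongrightarrow> 0) (at_right 0)" if N: "2 \<le> CARD('n)"
  proof -
    \<comment> \<open>For \<open>s > 0\<close> the flux equals
      \<open>s powr (a - 1 / 2) * \<phi>1 (sqrt s) / 2\<close>, with \<open>\<phi>1\<close>
      continuous at 0 and a positive exponent.\<close>
    have "isCont \<phi>1 0" unfolding \<phi>1_def[abs_def] by (rule DERIV_isCont[OF line[OF d(2)]]) simp
    moreover have "(sqrt \<longlongrightarrow> 0) (at_right 0)"
      using tendsto_real_sqrt[OF tendsto_ident_at[of 0 "{0<..}"]] by simp
    ultimately have "((\<lambda>s. \<phi>1 (sqrt s)) \<longlongrightarrow> \<phi>1 0) (at_right 0)"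
      by (rule isCont_tendsto_compose)
    moreover have "((\<lambda>s. s powr (a - 1 / 2) * (1 / 2)) \<longlongrightarrow> 0) (at_right 0)"
      using N by (intro powr_mult_tendsto_0) (auto simp: a_def)
    ultimately have "((\<lambda>s. s powr (a - 1 / 2) * (1 / 2) * \<phi>1 (sqrt s)) \<longlongrightarrow> 0 * \<phi>1 0) (at_right 0)"
      by (intro tendsto_mult)
    then have lim: "((\<lambda>s. s powr (a - 1 / 2) * (1 / 2) * \<phi>1 (sqrt s)) \<longlongrightarrow> 0) (at_right 0)" by simp
    have "s powr (a - 1 / 2) * (1 / 2) * \<phi>1 (sqrt s) = s powr a * D s" if "s > 0" for s
      using that by (simp add: D powr_diff powr_half_sqrt)
    then have "\<forall>\<^sub>F s in at_right 0. s powr (a - 1 / 2) * (1 / 2) * \<phi>1 (sqrt s) = s powr a * D s"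
      by (auto simp: eventually_at_filter)
    then show ?thesis using lim by (rule Lim_transform_eventually[rotated])
  qed
qed

section \<open>Comparison with the barrier\<close>

text \<open>\<open>radial_flux\<close> is applied to \<open>u\<close> and then to its Laplacian. The
  derivative in \<open>pU\<close> is taken within the closed ball, which keeps it continuous up to
  \<open>s = 1\<close>, where \<open>pU\<close> is half the normal derivative.\<close>

lemma minimal_solution_profile:
  fixes u :: "real^'n \<Rightarrow> real" and i :: 'n
  defines "U \<equiv> \<lambda>s. u (sqrt s *\<^sub>R axis i 1)"
    and "pU \<equiv> \<lambda>s. partial_deriv (cball 0 1) i u (sqrt s *\<^sub>R axis i 1) / (2 * sqrt s)"
  assumes u: "minimal_solution lam u" and N: "2 \<le> CARD('n)"
  shows "radial_bilaplace (real CARD('n) / 2) 1 U pU (\<lambda>s. lam / 16 / (1 - U s)\<^sup>2)"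
    and "U 1 = 0" and "pU 1 = 0" and "s \<in> {0..1} \<Longrightarrow> U s < 1"
    and "x \<in> ball 0 1 \<Longrightarrow> u x = U ((norm x)\<^sup>2)"
proof -
  let ?B = "ball (0::real^'n) 1" and ?C = "cball (0::real^'n) 1" and ?e = "axis i 1 :: real^'n"
  let ?a = "real CARD('n) / 2"
  have cl: "C_k_on 4 ?B u" "C_k_on 1 ?C u"
    "\<And>x. x \<in> ?B \<Longrightarrow> laplacian ?B (laplacian ?B u) x = lam / (1 - u x)\<^sup>2"
    "\<And>x. x \<in> ?B \<Longrightarrow> u x < 1" "\<And>x. x \<in> sphere 0 1 \<Longrightarrow> u x = 0 \<and> normal_deriv u x = 0"
    using u by (simp_all add: minimal_solution_def classical_solution_def del: C_k_on.simps One_nat_def)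
  have rad: "u x = u y" if "x \<in> ?B" "norm x = norm y" for x y
    using minimal_solution_radial[OF u that] .
  have C2: "C_k_on 2 ?B u" using cl(1) by (rule C_k_on_mono) simp
  have CL: "C_k_on 2 ?B (laplacian ?B u)"
  proof -
    have "C_k_on 2 ?B (partial_deriv ?B j (partial_deriv ?B j u))" for j
      using cl(1) by (simp add: numeral_eq_Suc)
    then show ?thesis
      unfolding laplacian_def[abs_def] by (intro C_k_on_sum unique_deriv_ball) auto
  qed
  have radL: "laplacian ?B u x = laplacian ?B u y" if "x \<in> ?B" "norm x = norm y" for x y
    by (rule laplacian_radially_symmetric[OF C2 rad that])
  have eB: "sqrt s *\<^sub>R ?e \<in> ?B" if "s \<in> {0<..<1}" for s using that by simp
  have eC: "sqrt s *\<^sub>R ?e \<in> ?C" if "s \<in> {0..1}" for s using that by simp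
  have pd: "partial_deriv ?C i u x = partial_deriv ?B i u x" if "x \<in> ?B" for x
  proof -
    have "x \<in> interior ?C" using that by simp
    then show ?thesis
      unfolding partial_deriv_def by (simp only: at_within_interior at_within_open[OF that open_ball])
  qed
  have cu: "continuous_on ?C u" "continuous_on ?C (partial_deriv ?C i u)"
    using cl(2) by (auto intro: differentiable_imp_continuous_on)
  show U1: "U 1 = 0" using cl(5)[of ?e] by (simp add: U_def)
  show "pU 1 = 0" using cl(5)[of ?e] by (simp add: pU_def normal_deriv_def partial_deriv_def)
  show "U s < 1" if "s \<in> {0..1}"
    using that cl(4)[of "sqrt s *\<^sub>R ?e"] U1 by (cases "s = 1") (auto simp: U_def)
  show "u x = U ((norm x)\<^sup>2)" if "x \<in> ?B"
    unfolding U_def using that by (intro rad) simp_all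
  have eq: "pU s = partial_deriv ?B i u (sqrt s *\<^sub>R ?e) / (2 * sqrt s)" if "s \<in> {0<..<1}" for s
    unfolding pU_def using pd[OF eB[OF that]] by simp
  have "\<forall>x\<in>?B. \<forall>y. norm x = norm y \<longrightarrow> u x = u y" using rad by blast
  note F = radial_flux[OF C2 this, where i = i]
  have "\<forall>x\<in>?B. \<forall>y. norm x = norm y \<longrightarrow> laplacian ?B u x = laplacian ?B u y" using radL by blast
  note FL = radial_flux[OF CL this, where i = i]
  let ?q = "\<lambda>s. partial_deriv ?B i (laplacian ?B u) (sqrt s *\<^sub>R ?e) / (2 * sqrt s)"
  show "radial_bilaplace ?a 1 U pU (\<lambda>s. lam / 16 / (1 - U s)\<^sup>2)"
  proof (rule radial_bilaplaceI[where L = "\<lambda>s. laplacian ?B u (sqrt s *\<^sub>R ?e) / 4" and q = "\<lambda>s. ?q s / 4"])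
    show "continuous_on {0..1} U"
      unfolding U_def by (rule continuous_on_compose2[OF cu(1)]) (use eC in \<open>auto intro!: continuous_intros\<close>)
    have "continuous_on {0<..1} (\<lambda>s. partial_deriv ?C i u (sqrt s *\<^sub>R ?e))"
      by (rule continuous_on_compose2[OF cu(2)]) (use eC in \<open>auto intro!: continuous_intros\<close>)
    then show "continuous_on {0<..1} pU"
      unfolding pU_def by (auto intro!: continuous_intros)
    show "((\<lambda>s. s powr ?a * pU s) \<longlongrightarrow> 0) (at_right 0)"
    proof (rule Lim_transform_eventually[OF F(3)[OF N]])
      show "\<forall>\<^sub>F s in at_right 0. s powr ?a * (partial_deriv ?B i u (sqrt s *\<^sub>R ?e) / (2 * sqrt s)) = s powr ?a * pU s"
        using eventually_at_right_real[of 0 1] eq by (auto elim!: eventually_mono)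
    qed
    show "((\<lambda>s. s powr ?a * (?q s / 4)) \<longlongrightarrow> 0) (at_right 0)"
      using tendsto_divide[OF FL(3)[OF N] tendsto_const[of 4]] by simp
    fix s :: real assume s: "s \<in> {0<..<1}"
    show "(U has_real_derivative pU s) (at s)"
      unfolding U_def eq[OF s] by (rule F(1)[OF s])
    show "((\<lambda>s. s powr ?a * pU s) has_real_derivative
        s powr (?a - 1) * (laplacian ?B u (sqrt s *\<^sub>R ?e) / 4)) (at s)"
      by (rule has_field_derivative_transform_within_open[OF F(2)[OF s] _ s]) (simp_all add: eq)
    show "((\<lambda>s. laplacian ?B u (sqrt s *\<^sub>R ?e) / 4) has_real_derivative ?q s / 4) (at s)"
      by (rule DERIV_cdivide[OF FL(1)[OF s]])
    show "((\<lambda>s. s powr ?a * (?q s / 4)) has_real_derivative s powr (?a - 1) * (lam / 16 / (1 - U s)\<^sup>2)) (at s)"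
      using DERIV_cdivide[OF FL(2)[OF s], of 4] cl(3)[OF eB[OF s]] by (simp add: U_def)
  qed
qed

text \<open>Differentiating \<open>s powr a * s powr d\<close> brings down \<open>a + d\<close>;
  \<open>d = - 1 / 3\<close> and \<open>d = - 4 / 3\<close> give the two factors of
  \<open>\<kappa>\<close>. The assumption on \<open>a\<close> makes even the more singular flux, of
  order \<open>s powr (a - 4 / 3)\<close>, vanish at the origin.\<close>

lemma barrier_bilaplace:
  fixes C \<gamma> a :: real
  assumes a: "4 / 3 < a"
  defines "\<kappa> \<equiv> 2 / 9 * (a - 1 / 3) * (a - 4 / 3)"
  shows "radial_bilaplace a R (\<lambda>s. 1 - \<gamma> - C * s powr (2 / 3)) (\<lambda>s. - (2 / 3 * C) * s powr (- 1 / 3))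
           (\<lambda>s. C * \<kappa> * s powr (- 4 / 3))"
proof (rule radial_bilaplaceI[where L = "\<lambda>s. - (2 / 3 * C) * (a - 1 / 3) * s powr (- 1 / 3)"
      and q = "\<lambda>s. 2 / 9 * C * (a - 1 / 3) * s powr (- 4 / 3)"])
  have lim: "((\<lambda>s. s powr a * (k * s powr - d)) \<longlongrightarrow> 0) (at_right 0)" if "d < a" for k d
  proof -
    have "((\<lambda>s. s powr (a - d) * k) \<longlongrightarrow> 0) (at_right 0)"
      using that by (intro powr_mult_tendsto_0) auto
    moreover have "\<forall>\<^sub>F s in at_right 0. s powr (a - d) * k = s powr a * (k * s powr - d)"
      by (auto simp: eventually_at_filter powr_diff powr_minus_divide)
    ultimately show ?thesis by (rule Lim_transform_eventually)
  qed
  show "continuous_on {0..R} (\<lambda>s. 1 - \<gamma> - C * s powr (2 / 3))"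
    by (intro continuous_on_diff continuous_on_mult continuous_on_powr' continuous_intros) auto
  show "continuous_on {0<..R} (\<lambda>s. - (2 / 3 * C) * s powr (- 1 / 3))"
    by (intro continuous_on_mult continuous_on_powr continuous_intros) auto
  show "((\<lambda>s. s powr a * (- (2 / 3 * C) * s powr (- 1 / 3))) \<longlongrightarrow> 0) (at_right 0)"
    using lim[of "1 / 3" "- (2 / 3 * C)"] a by simp
  show "((\<lambda>s. s powr a * (2 / 9 * C * (a - 1 / 3) * s powr (- 4 / 3))) \<longlongrightarrow> 0) (at_right 0)"
    using lim[of "4 / 3" "2 / 9 * C * (a - 1 / 3)"] a by simp
  fix s assume "s \<in> {0<..<R}"
  then have s: "0 < s" by simp
  have pw: "((\<lambda>s. k * s powr d) has_real_derivative k * (d * s powr (d - 1))) (at s)" for k d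
    using s by (intro DERIV_cmult has_real_derivative_powr)
  have flux: "((\<lambda>s. s powr a * (k * s powr d)) has_real_derivative
      s powr (a - 1) * (k * (a + d) * s powr d)) (at s)" for k d
  proof -
    have "((\<lambda>s. s powr a * (k * s powr d)) has_real_derivative k * ((a + d) * s powr (a + d - 1))) (at s)"
      by (rule has_field_derivative_transform_within_open[OF pw[of k "a + d"] open_greaterThan[of 0]])
        (use s in \<open>auto simp: powr_add\<close>)
    moreover have "s powr (a + d - 1) = s powr (a - 1) * s powr d"
      by (simp add: algebra_simps flip: powr_add)
    ultimately show ?thesis by (simp add: mult_ac)
  qed
  show "((\<lambda>s. 1 - \<gamma> - C * s powr (2 / 3)) has_real_derivative - (2 / 3 * C) * s powr (- 1 / 3)) (at s)"
    by (rule DERIV_cong[OF DERIV_diff[OF DERIV_const pw]]) simp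
  show "((\<lambda>s. s powr a * (- (2 / 3 * C) * s powr (- 1 / 3))) has_real_derivative
      s powr (a - 1) * (- (2 / 3 * C) * (a - 1 / 3) * s powr (- 1 / 3))) (at s)"
    using flux[of "- (2 / 3 * C)" "- 1 / 3"] by simp
  show "((\<lambda>s. - (2 / 3 * C) * (a - 1 / 3) * s powr (- 1 / 3)) has_real_derivative
      2 / 9 * C * (a - 1 / 3) * s powr (- 4 / 3)) (at s)"
    using pw[of "- (2 / 3 * C) * (a - 1 / 3)" "- 1 / 3"] by simp
  show "((\<lambda>s. s powr a * (2 / 9 * C * (a - 1 / 3) * s powr (- 4 / 3))) has_real_derivative
      s powr (a - 1) * (C * \<kappa> * s powr (- 4 / 3))) (at s)"
    using flux[of "2 / 9 * C * (a - 1 / 3)" "- 4 / 3"] by (simp add: \<kappa>_def mult_ac)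
qed

lemma minimal_solution_barrier:
  fixes u :: "real^'n \<Rightarrow> real"
  assumes u: "minimal_solution lam u" and N: "3 \<le> CARD('n)" and lam: "0 < lam"
    and x0: "x0 \<in> ball 0 1" "x0 \<noteq> 0" and C: "0 < C" "lam \<le> C ^ 3 * lambda_bar CARD('n)" and \<gamma>: "0 < \<gamma>"
    and ux0: "u x0 \<le> 1 - C * norm x0 powr (4 / 3) - \<gamma>"
  shows "u 0 \<le> 1 - \<gamma>"
proof -
  fix i :: 'n
  define U where "U s = u (sqrt s *\<^sub>R axis i 1)" for s
  define pU where "pU s = partial_deriv (cball 0 1) i u (sqrt s *\<^sub>R axis i 1) / (2 * sqrt s)" for s
  define b where "b = real CARD('n) / 2 - 1"
  have b: "0 < b" using N by (simp add: b_def)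
  have N2: "2 \<le> CARD('n)" using N by simp
  have ab: "real CARD('n) / 2 = b + 1" by (simp add: b_def)
  note prof = minimal_solution_profile[OF u N2, where i = i, unfolded ab]
  have U: "radial_bilaplace (b + 1) 1 U pU (\<lambda>s. lam / 16 / (1 - U s)\<^sup>2)" "U 1 = 0" "pU 1 = 0"
    "\<And>s. s \<in> {0..1} \<Longrightarrow> U s < 1" "\<And>x. x \<in> ball 0 1 \<Longrightarrow> u x = U ((norm x)\<^sup>2)"
    unfolding U_def[abs_def] pU_def[abs_def] by (fact prof)+
  define s0 where "s0 = (norm x0)\<^sup>2"
  have s0: "0 < s0" "s0 < 1" using x0 by (auto simp: s0_def power_less_one_iff)
  define W where "W s = 1 - \<gamma> - C * s powr (2 / 3)" for s
  define pW where "pW s = - (2 / 3 * C) * s powr (- 1 / 3)" for s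
  define \<kappa> where "\<kappa> = 2 / 9 * (b + 1 - 1 / 3) * (b + 1 - 4 / 3)"
  have \<kappa>: "\<kappa> = lambda_bar CARD('n) / 16"
    by (simp add: \<kappa>_def b_def lambda_bar_def field_simps)
  have Wb: "radial_bilaplace (b + 1) R W pW (\<lambda>s. C * \<kappa> * s powr (- 4 / 3))" for R
    unfolding W_def[abs_def] pW_def[abs_def] \<kappa>_def using N by (intro barrier_bilaplace) (simp add: b_def)
  have "norm x0 powr (4 / 3) = s0 powr (2 / 3)"
    using x0 by (simp add: s0_def powr_powr flip: powr_numeral)
  then have UW0: "U s0 \<le> W s0" using ux0 U(5)[OF x0(1)] by (simp add: W_def s0_def)
  define g where "g s = W s - U s" for s
  have cg: "continuous_on {0..1} g"
    using U(1) Wb[of 1] unfolding radial_bilaplace_def g_def[abs_def] by (intro continuous_intros) auto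
  \<comment> \<open>Maximizing over [s0, 1] keeps the squared radius \<open>R\<close> away from 0,
    and the value at \<open>s0\<close> makes the maximum nonnegative.\<close>
  obtain R where R: "R \<in> {s0..1}" and max: "\<And>s. s \<in> {s0..1} \<Longrightarrow> g s \<le> g R"
    using continuous_attains_sup[OF compact_Icc[of s0 1] _ continuous_on_subset[OF cg]] s0 by auto
  have UR: "U R \<le> W R" using max[of s0] UW0 s0 by (simp add: g_def)
  \<comment> \<open>The maximum may sit at the left endpoint \<open>s0\<close>, so the argument uses
    only that \<open>g\<close> cannot exceed \<open>g R\<close> to the right of \<open>R\<close>. At
    \<open>R = 1\<close> the slope of \<open>U\<close> is zero and that of the barrier is
    negative.\<close>
  have pR: "pW R \<le> pU R"
  proof (cases "R = 1")
    case True
    then show ?thesis using U(3) C(1) by (simp add: pW_def)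
  next
    case False
    then have R': "R \<in> {0<..<1}" using R s0 by auto
    have "(W has_real_derivative pW R) (at R)" "(U has_real_derivative pU R) (at R)"
      using Wb[of 1] U(1) R' unfolding radial_bilaplace_def by blast+
    then have d: "(g has_real_derivative pW R - pU R) (at R)"
      unfolding g_def[abs_def] by (rule DERIV_diff)
    show ?thesis
    proof (rule ccontr)
      assume "\<not> ?thesis"
      then have "0 < pW R - pU R" by simp
      from DERIV_pos_inc_right[OF d this] obtain e where e: "e > 0" "\<And>h. 0 < h \<Longrightarrow> h < e \<Longrightarrow> g R < g (R + h)"
        by auto
      define h where "h = min (e / 2) (1 - R)"
      have "0 < h" "h < e" "R + h \<le> 1" using e(1) R' by (auto simp: h_def)
      then show False using e(2)[of h] max[of "R + h"] R by auto
    qed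
  qed
  have W1: "W s < 1" for s
    using \<gamma> C(1) by (smt (verit) W_def mult_nonneg_nonneg powr_ge_zero)
  \<comment> \<open>Since \<open>1 - W s >= C * s powr (2 / 3)\<close>, the left side grows when
    \<gamma> is dropped; then \<open>lam <= C ^ 3 * 16 * \<kappa>\<close> finishes the
    estimate.\<close>
  have hW: "lam / 16 / (1 - W s)\<^sup>2 \<le> C * \<kappa> * s powr (- 4 / 3)" if s: "0 < s" for s
  proof -
    have sq: "(s powr (2 / 3))\<^sup>2 = s powr (4 / 3)"
      using s by (simp add: powr_powr flip: powr_numeral)
    have pos: "0 < s powr (2 / 3)" "0 < s powr (4 / 3)" using s by auto
    have "(C * s powr (2 / 3))\<^sup>2 \<le> (1 - W s)\<^sup>2"
      using C(1) \<gamma> pos by (intro power_mono) (auto simp: W_def)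
    then have "lam / 16 / (1 - W s)\<^sup>2 \<le> lam / 16 / (C * s powr (2 / 3))\<^sup>2"
      using lam C(1) pos W1[of s] by (intro divide_left_mono mult_pos_pos) auto
    also have "\<dots> \<le> (C ^ 3 * (16 * \<kappa>)) / 16 / (C * s powr (2 / 3))\<^sup>2"
      using C(2) by (intro divide_right_mono) (auto simp: \<kappa>)
    also have "\<dots> = C * \<kappa> * s powr (- 4 / 3)"
      unfolding power_mult_distrib sq using C(1) pos
      by (simp add: powr_minus_divide power2_eq_square power3_eq_cube)
    finally show ?thesis .
  qed
  obtain V where V: "continuous_on {0..1} V" "\<And>s. s \<in> {0..1} \<Longrightarrow> V s \<le> U s" "\<And>s. s \<in> {0..1} \<Longrightarrow> 0 \<le> V s"
    "\<And>s. s \<in> {0..R} \<Longrightarrow> V s \<le> W s" "\<And>s. s \<in> {0..1} \<Longrightarrow> V s = green b (\<lambda>s. lam / 16 / (1 - V s)\<^sup>2) s"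
  proof (rule fixed_point_below_barrier[OF b _ _ _ U(1-4) Wb UR pR W1 hW])
    show "0 < lam / 16" "0 < R" "R \<le> 1" using lam R s0 by auto
  qed auto
  have V1: "V s < 1" if "s \<in> {0..1}" for s using V(2)[OF that] U(4)[OF that] by simp
  \<comment> \<open>Here minimality enters: the fixed point is a classical solution, hence lies
    above \<open>u\<close>, while at the origin it stays below
    \<open>W 0 = 1 - \<gamma>\<close>.\<close>
  have "classical_solution lam (\<lambda>x::real^'n. green b (\<lambda>s. lam / 16 / (1 - V s)\<^sup>2) ((norm x)\<^sup>2))"
    by (rule classical_solution_fixed_point[OF N lam V(1,3) V1 b_def refl V(5)])
  then have "u 0 \<le> green b (\<lambda>s. lam / 16 / (1 - V s)\<^sup>2) ((norm (0::real^'n))\<^sup>2)"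
    by (rule u[unfolded minimal_solution_def, THEN conjunct2, rule_format]) simp
  also have "\<dots> = V 0" using V(5)[of 0] by simp
  also have "\<dots> \<le> W 0" using V(4)[of 0] R s0 by simp
  finally show ?thesis by (simp add: W_def)
qed

text \<open>The right-hand side is nonnegative and the slope at the boundary is zero, so Boggio's
  principle on the unit ball makes the profile nonincreasing.\<close>

lemma minimal_solution_max_origin:
  fixes u :: "real^'n \<Rightarrow> real"
  assumes u: "minimal_solution lam u" and N: "2 \<le> CARD('n)" and lam: "0 < lam" and x: "x \<in> ball 0 1"
  shows "u x \<le> u 0"
proof -
  fix i :: 'n
  note prof = minimal_solution_profile[OF u N, where i = i]
  have "u (sqrt ((norm x)\<^sup>2) *\<^sub>R axis i 1) \<le> u (sqrt 0 *\<^sub>R axis i 1)"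
    by (rule radial_boggio(2)[OF prof(1)]) (use lam x prof(3) in \<open>simp_all add: power_le_one\<close>)
  then show ?thesis using prof(5)[OF x] by simp
qed

section \<open>Passage to the extremal parameter\<close>

theorem theorem3p2:
  fixes ustar :: "real^'n \<Rightarrow> real" and lamstar :: real
  assumes "CARD('n) \<ge> 5"
    and "extremal_pair ustar lamstar"
    and "(SUP x\<in>ball 0 1. ustar x) = 1"
  shows "\<forall>x\<in>ball 0 1.
    1 - ustar x \<le> (lamstar / lambda_bar CARD('n)) powr (1 / 3) * norm x powr (4 / 3)"
proof
  fix x0 :: "real^'n" assume x0: "x0 \<in> ball 0 1"
  let ?C = "(lamstar / lambda_bar CARD('n)) powr (1 / 3)"
  have lb: "0 < lambda_bar CARD('n)"
    using assms(1) by (simp add: lambda_bar_def)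
  obtain U where sup: "ereal lamstar = pull_in_voltage TYPE('n)"
    and U: "\<And>t. t \<in> {0<..<lamstar} \<Longrightarrow> minimal_solution t (U t)"
    and lim: "\<And>x. x \<in> ball 0 1 \<Longrightarrow> ((\<lambda>t. U t x) \<longlongrightarrow> ustar x) (at_left lamstar)"
    using assms(2) unfolding extremal_pair_def by blast
  \<comment> \<open>An empty set of parameters would have supremum \<open>- \<infinity>\<close>,
    which is not the real \<open>lamstar\<close>. Any member is positive and bounds
    \<open>lamstar\<close> from below.\<close>
  have lam: "0 < lamstar"
  proof -
    let ?A = "{lam. 0 < lam \<and> (\<exists>u :: real^'n \<Rightarrow> real. classical_solution lam u)}"
    have "?A \<noteq> {}"
    proof
      assume "?A = {}"
      then have "pull_in_voltage TYPE('n) = - \<infinity>"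
        unfolding pull_in_voltage_def by (simp only: image_empty Sup_empty bot_ereal_def)
      then show False using sup by simp
    qed
    then obtain l where "l \<in> ?A" by blast
    then have "0 < l" "ereal l \<le> ereal lamstar"
      unfolding sup pull_in_voltage_def by (auto intro!: Sup_upper)
    then show ?thesis by simp
  qed
  have ev: "\<forall>\<^sub>F t in at_left lamstar. t \<in> {0<..<lamstar}"
    using eventually_at_left_real[OF lam] .
  \<comment> \<open>The maximum at the origin survives the limit, so a supremum of 1 gives
    \<open>1 <= ustar 0\<close>.\<close>
  have "ustar x \<le> ustar 0" if x: "x \<in> ball 0 1" for x
  proof (rule tendsto_le[OF _ lim lim[OF x]])
    show "\<forall>\<^sub>F t in at_left lamstar. U t x \<le> U t 0"
      using ev by (rule eventually_mono)
        (use assms(1) in \<open>auto intro!: minimal_solution_max_origin[OF U _ _ x]\<close>)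
  qed auto
  then have "(SUP x\<in>ball 0 1. ustar x) \<le> ustar 0"
    by (intro cSUP_least) auto
  then have ustar0: "1 \<le> ustar 0" using assms(3) by simp
  show "1 - ustar x0 \<le> ?C * norm x0 powr (4 / 3)"
  proof (cases "x0 = 0")
    case True
    then show ?thesis using ustar0 by simp
  next
    case False
    show ?thesis
    proof (rule ccontr)
      assume less: "\<not> ?thesis"
      \<comment> \<open>With half of the gap as \<gamma>, the inequality at \<open>x0\<close> is
        still strict, so it passes to \<open>U t\<close> for \<open>t\<close> close to
        \<open>lamstar\<close>.\<close>
      define \<gamma> where "\<gamma> = (1 - ?C * norm x0 powr (4 / 3) - ustar x0) / 2"
      have \<gamma>: "0 < \<gamma>" "ustar x0 < 1 - ?C * norm x0 powr (4 / 3) - \<gamma>"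
        using less by (auto simp: \<gamma>_def field_simps)
      have C: "0 < ?C" using lam lb by simp
      \<comment> \<open>This fixes the constant: \<open>?C ^ 3 * lambda_bar CARD('n)\<close> is
        exactly \<open>lamstar\<close>, so one barrier serves every \<open>t\<close> below
        \<open>lamstar\<close>.\<close>
      have "?C ^ 3 = lamstar / lambda_bar CARD('n)"
        using lam lb by (simp add: powr_powr flip: powr_numeral)
      then have C3: "?C ^ 3 * lambda_bar CARD('n) = lamstar" using lb by simp
      have "\<forall>\<^sub>F t in at_left lamstar. U t 0 \<le> 1 - \<gamma>"
        using ev order_tendstoD(2)[OF lim[OF x0] \<gamma>(2)]
      proof eventually_elim
        case (elim t)
        then show ?case
          using assms(1) C3 by (intro minimal_solution_barrier[OF U _ _ x0 False C _ \<gamma>(1)]) auto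
      qed
      then have "ustar 0 \<le> 1 - \<gamma>"
        by (intro tendsto_upperbound[OF lim]) auto
      then show False using ustar0 \<gamma>(1) by simp
    qed
  qed
qed

end
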